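(* For $|q|<1$ (with $q^{1/2}$ a fixed square root of $q$, all fractional powers of $q$ being interpreted consistently via $q^{1/2}$), the following three identities hold: \begin{align*} \sum_{i,j,k\geq 0} \frac{q^{\frac{1}{2}i^2+j^2+k^2-ik-jk-\frac{1}{2}i-\frac{1}{2}j}}{(q;q)_i(q^2;q^2)_j(q^2;q^2)_k}&=4(1+q^{-1/2})\frac{(q^2;q^2)_\infty}{(q^{1/2};q^{1/2})_\infty},\\ \sum_{i,j,k\geq 0} \frac{q^{\frac{1}{2}i^2+j^2+k^2-ik-jk+\frac{1}{2}i+j-k}}{(q;q)_i(q^2;q^2)_j(q^2;q^2)_k}&=3\frac{(q^2;q^2)_\infty^3}{(q;q)_\infty^3},\\ \sum_{i,j,k\geq 0} \frac{q^{\frac{1}{2}i^2+j^2+k^2-ik-jk+\frac{1}{2}i+j}}{(q;q)_i(q^2;q^2)_j(q^2;q^2)_k}&=\frac{(q^2;q^2)_\infty^3}{(q;q)_\infty^3}. \end{align*}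
   Context: For a complex number $a$ and $|q|<1$, $(a;q)_n:=\prod_{k=0}^{n-1}(1-aq^k)$ for $n\in\mathbb{N}\cup\{\infty\}$. Sums run over nonnegative integers $i,j,k$. *)

theory Defs
  imports "HOL-Analysis.Analysis"
begin

definition qpoch :: "complex \<Rightarrow> complex \<Rightarrow> nat \<Rightarrow> complex" where
  "qpoch a q n = (\<Prod>k<n. (1 - a * q ^ k))"

definition qpoch_inf :: "complex \<Rightarrow> complex \<Rightarrow> complex" where
  "qpoch_inf a q = (\<Prod>k. (1 - a * q ^ k))"

end

theory Submission
  imports Defs
begin

text \<open>Write $P = (-q;q)_\infty$. Euler's identity sums the series over $i$. When the coefficient of
  $i$ in the exponent is $-1/2$, the resulting product $(-q^{-k};q)_\infty$ is $2P q^{-k(k+1)/2} (-q;q)_k$, which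
  turns $(q^2;q^2)_k$ into $(q;q)_k$, so that Euler's identity applies again over $k$, and for the
  same reason over $j$. This gives the first identity, and the value $4P^3$ for the sum $T$ with linear
  form $-i/2 + j$. Termwise, $T$ is the sum of the left-hand sides of the second and third identity, so
  only the third remains. There, summing over $i$ and $j$ leaves a single sum over $k$ with the denominator
  $(q;q)_k (1 + q^k)$; its even and odd parts are transforms of the Lambert series
  $\sum (-q)^n/(1+q^{2n})$ and $\sum (-q^2)^n/(1+q^{2n+1})$, and expanding both geometrically
  shows that all but the constant $1/2$ cancels.\<close>

section \<open>Finite and infinite q-Pochhammer symbols\<close>

lemma qpoch_0 [simp]: "qpoch a q 0 = 1"
  by (simp add: qpoch_def)

lemma qpoch_Suc: "qpoch a q (Suc n) = qpoch a q n * (1 - a * q ^ n)"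
  by (simp add: qpoch_def)

lemma qpoch_add: "qpoch a q (m + n) = qpoch a q m * qpoch (a * q ^ m) q n"
  by (induction n) (simp_all add: qpoch_Suc power_add mult.assoc)

lemma qpoch_Suc_left: "qpoch a q (Suc n) = (1 - a) * qpoch (a * q) q n"
  using qpoch_add[of a q 1 n] by (simp add: qpoch_def)

lemma qpoch_mult_neg: "qpoch a q n * qpoch (- a) q n = qpoch (a\<^sup>2) (q\<^sup>2) n"
proof (induction n)
  case (Suc n)
  have "qpoch a q (Suc n) * qpoch (- a) q (Suc n) =
      (qpoch a q n * qpoch (- a) q n) * ((1 - a * q ^ n) * (1 + a * q ^ n))"
    by (simp add: qpoch_Suc algebra_simps)
  also have "(1 - a * q ^ n) * (1 + a * q ^ n) = 1 - a\<^sup>2 * (q\<^sup>2) ^ n"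
    by (simp add: algebra_simps power2_eq_square power_mult_distrib)
  finally show ?case
    using Suc by (simp add: qpoch_Suc)
qed simp

lemma qpoch_double: "qpoch a q (2 * n) = qpoch a (q\<^sup>2) n * qpoch (a * q) (q\<^sup>2) n"
proof (induction n)
  case (Suc n)
  have "qpoch a q (2 * Suc n) = qpoch a q (2 * n) * ((1 - a * q ^ (2 * n)) * (1 - a * q ^ (2 * n + 1)))"
    by (simp add: qpoch_Suc)
  then show ?case
    using Suc by (simp add: qpoch_Suc power_mult[symmetric] mult_ac)
qed simp

section \<open>Convergence, non-vanishing and boundedness\<close>

lemma convergent_prod_qpoch:
  fixes a q :: complex
  assumes "norm q < 1"
  shows "convergent_prod (\<lambda>k. 1 - a * q ^ k)"
proof -
  have "(\<lambda>k. norm (1 - a * q ^ k - 1)) = (\<lambda>k. norm a * norm q ^ k)"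
    by (simp add: norm_mult norm_power)
  then have "summable (\<lambda>k. norm (1 - a * q ^ k - 1))"
    by (simp only:) (simp add: summable_mult summable_geometric assms)
  then show ?thesis
    by (intro abs_convergent_prod_imp_convergent_prod summable_imp_abs_convergent_prod)
qed

lemma qpoch_tendsto:
  assumes "norm q < 1"
  shows "(\<lambda>n. qpoch a q n) \<longlonglongrightarrow> qpoch_inf a q"
  using convergent_prod_LIMSEQ[OF convergent_prod_qpoch[OF assms, of a]]
  unfolding qpoch_def qpoch_inf_def by (simp add: LIMSEQ_lessThan_iff_atMost)

lemma qpoch_inf_nonzero:
  assumes "norm q < 1" "\<And>k. a * q ^ k \<noteq> 1"
  shows "qpoch_inf a q \<noteq> 0"
  unfolding qpoch_inf_def using assms
  by (intro prodinf_nonzero convergent_prod_qpoch) (auto simp: eq_commute[of 1])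

lemma qpoch_nonzero: "(\<And>k. a * q ^ k \<noteq> 1) \<Longrightarrow> qpoch a q n \<noteq> 0"
  by (auto simp: qpoch_def eq_commute[of 1])

lemma mult_power_neq_1:
  fixes a q :: complex
  assumes "norm q < 1" "norm a < 1"
  shows "a * q ^ k \<noteq> 1"
proof
  assume "a * q ^ k = 1"
  then have "norm a * norm q ^ k = 1"
    by (metis norm_mult norm_power norm_one)
  moreover have "norm a * norm q ^ k \<le> norm a * 1"
    using assms by (intro mult_left_mono power_le_one) auto
  ultimately show False
    using assms by simp
qed

lemma qpoch_nonzero': "norm q < 1 \<Longrightarrow> norm a < 1 \<Longrightarrow> qpoch a q n \<noteq> 0"
  by (intro qpoch_nonzero mult_power_neq_1)

lemma qpoch_inf_nonzero': "norm q < 1 \<Longrightarrow> norm a < 1 \<Longrightarrow> qpoch_inf a q \<noteq> 0"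
  by (intro qpoch_inf_nonzero mult_power_neq_1)

text \<open>Together with \<open>inverse_qpoch_bounded\<close>, this lets constants replace the
  q-Pochhammer factors in the geometric majorants of the multiple series.\<close>

lemma qpoch_bounded:
  assumes "norm q < 1"
  obtains C where "C > 0" "\<And>n. norm (qpoch a q n) \<le> C"
  using Bseq_def convergent_imp_Bseq convergentI[OF qpoch_tendsto[OF assms, of a]] by metis

lemma inverse_qpoch_bounded:
  assumes "norm q < 1" "norm a < 1"
  obtains C where "C > 0" "\<And>n. norm (inverse (qpoch a q n)) \<le> C"
proof -
  have "(\<lambda>n. inverse (qpoch a q n)) \<longlonglongrightarrow> inverse (qpoch_inf a q)"
    using assms by (intro tendsto_inverse qpoch_tendsto qpoch_inf_nonzero')
  then show ?thesis
    using that Bseq_def convergent_imp_Bseq convergentI by metis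
qed

section \<open>Product identities\<close>

lemma qpoch_inf_split:
  assumes "norm q < 1"
  shows "qpoch_inf a q = qpoch a q m * qpoch_inf (a * q ^ m) q"
proof -
  have "(\<lambda>n. qpoch a q (m + n)) \<longlonglongrightarrow> qpoch_inf a q"
    using LIMSEQ_ignore_initial_segment[OF qpoch_tendsto[OF assms, of a], of m]
    by (simp add: add.commute)
  moreover have "(\<lambda>n. qpoch a q (m + n)) \<longlonglongrightarrow> qpoch a q m * qpoch_inf (a * q ^ m) q"
    unfolding qpoch_add using assms by (intro tendsto_mult tendsto_const qpoch_tendsto)
  ultimately show ?thesis
    by (rule LIMSEQ_unique)
qed

lemma qpoch_inf_Suc:
  assumes "norm q < 1"
  shows "qpoch_inf a q = (1 - a) * qpoch_inf (a * q) q"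
  using qpoch_inf_split[OF assms, of a 1] by (simp add: qpoch_def)

lemma norm_power2_less_1: "norm q < 1 \<Longrightarrow> norm (q\<^sup>2) < 1" for q :: complex
  by (simp add: norm_power power_less_one_iff)

lemma qpoch_inf_mult_neg:
  assumes "norm q < 1"
  shows "qpoch_inf a q * qpoch_inf (- a) q = qpoch_inf (a\<^sup>2) (q\<^sup>2)"
proof (rule LIMSEQ_unique)
  show "(\<lambda>n. qpoch (a\<^sup>2) (q\<^sup>2) n) \<longlonglongrightarrow> qpoch_inf a q * qpoch_inf (- a) q"
    unfolding qpoch_mult_neg[symmetric] using assms by (intro tendsto_mult qpoch_tendsto)
qed (use assms norm_power2_less_1 in \<open>intro qpoch_tendsto\<close>)

lemma qpoch_inf_double:
  assumes "norm q < 1"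
  shows "qpoch_inf a q = qpoch_inf a (q\<^sup>2) * qpoch_inf (a * q) (q\<^sup>2)"
proof (rule LIMSEQ_unique)
  show "(\<lambda>n. qpoch a q (2 * n)) \<longlonglongrightarrow> qpoch_inf a q"
    using LIMSEQ_subseq_LIMSEQ[OF qpoch_tendsto[OF assms, of a], of "\<lambda>n. 2 * n"]
    by (simp add: strict_mono_def o_def)
  show "(\<lambda>n. qpoch a q (2 * n)) \<longlonglongrightarrow> qpoch_inf a (q\<^sup>2) * qpoch_inf (a * q) (q\<^sup>2)"
    unfolding qpoch_double using assms by (intro tendsto_mult qpoch_tendsto norm_power2_less_1)
qed

text \<open>Product form of Euler's theorem on partitions into odd and into distinct parts:
  (q;q)_\<infinity> = (q;q^2)_\<infinity> (q^2;q^2)_\<infinity> and (q^2;q^2)_\<infinity> =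
  (q;q)_\<infinity> (-q;q)_\<infinity>, and the nonzero (q;q)_\<infinity> cancels.\<close>

lemma euler_odd_distinct:
  assumes "norm q < 1"
  shows "qpoch_inf q (q\<^sup>2) * qpoch_inf (- q) q = 1"
proof -
  have "qpoch_inf q (q\<^sup>2) * qpoch_inf (- q) q * qpoch_inf q q = qpoch_inf q q"
    using qpoch_inf_double[OF assms, of q] qpoch_inf_mult_neg[OF assms, of q]
    by (simp add: power2_eq_square algebra_simps)
  then show ?thesis
    using qpoch_inf_nonzero'[OF assms assms] by simp
qed

text \<open>The theta-type symmetry $1 + c p^{-l} = c p^{-l}(1 + p^l/c)$, applied to the first $m$ factors.\<close>

lemma qpoch_inf_shift_neg:
  assumes "norm p < 1" "r\<^sup>2 = p" "r \<noteq> 0" "c \<noteq> 0"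
  shows "qpoch_inf (- (c / p ^ m)) p * r ^ (m\<^sup>2 + m) =
    c ^ m * qpoch (- (p / c)) p m * qpoch_inf (- c) p"
proof (induction m)
  case (Suc m)
  have p: "p \<noteq> 0"
    using assms by auto
  \<comment> \<open>The root \<open>r\<close> keeps halves out of the exponents: r^(m^2+m) stands
    for p^(m(m+1)/2), and the step from m to m+1 multiplies it by p^(m+1).\<close>
  have e: "(Suc m)\<^sup>2 + Suc m = m\<^sup>2 + m + 2 * Suc m"
    by (simp add: power2_eq_square)
  have "r ^ ((Suc m)\<^sup>2 + Suc m) = r ^ (m\<^sup>2 + m) * p ^ Suc m"
    unfolding e power_add[of r "m\<^sup>2 + m"] power_mult assms ..
  moreover have "qpoch_inf (- (c / p ^ Suc m)) p =
      (1 + c / p ^ Suc m) * qpoch_inf (- (c / p ^ m)) p"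
    using qpoch_inf_Suc[OF assms(1), of "- (c / p ^ Suc m)"] p by simp
  ultimately have "qpoch_inf (- (c / p ^ Suc m)) p * r ^ ((Suc m)\<^sup>2 + Suc m) =
     (1 + c / p ^ Suc m) * p ^ Suc m * (qpoch_inf (- (c / p ^ m)) p * r ^ (m\<^sup>2 + m))"
    by simp
  also have "(1 + c / p ^ Suc m) * p ^ Suc m = c * (1 + p / c * p ^ m)"
    using p assms by (simp add: field_simps)
  finally show ?case
    unfolding Suc by (simp add: qpoch_Suc)
qed simp

section \<open>The q-binomial theorem and Euler's identity\<close>

text \<open>The recurrence is the coefficient form of F(x) (1 - b x) = (1 - a x) F(x q). Iterating
  this while z q^n tends to 0 leaves a quotient of two infinite products. Taking b = 1 gives the
  q-binomial theorem and b = 0 Euler's identity.\<close>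

lemma q_binomial_recurrence:
  assumes q: "norm q < 1" and "c 0 = 1"
    and rec: "\<And>n. c (Suc n) * (1 - q ^ Suc n) = (b - a * q ^ n) * c n"
    and bz: "norm (b * z) < 1"
  shows "summable (\<lambda>n. norm (c n * z ^ n))"
    and "(\<Sum>n. c n * z ^ n) * qpoch_inf (b * z) q = qpoch_inf (a * z) q"
proof -
  have nz: "1 - q ^ Suc n \<noteq> 0" for n
    using mult_power_neq_1[OF q q, of n] by simp
  have c_Suc: "c (Suc n) = (b - a * q ^ n) / (1 - q ^ Suc n) * c n" for n
    using rec[of n] nz[of n] by (simp add: field_simps)
  \<comment> \<open>Ratio test: the quotient of consecutive terms tends to b x, so any
    \<open>t\<close> strictly between its norm and 1 works eventually.\<close>
  have sum: "summable (\<lambda>n. norm (c n * x ^ n))" if "norm (b * x) < 1" for x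
  proof -
    obtain t where t: "norm (b * x) < t" "t < 1"
      using \<open>norm (b * x) < 1\<close> dense by blast
    have qn: "(\<lambda>n. q ^ n) \<longlonglongrightarrow> 0"
      using q by (rule LIMSEQ_power_zero)
    have "(\<lambda>n. (b - a * q ^ n) / (1 - q ^ Suc n) * x) \<longlonglongrightarrow> (b - a * 0) / (1 - 0) * x"
      by (intro tendsto_intros qn LIMSEQ_Suc[OF qn]) auto
    then have "(\<lambda>n. norm ((b - a * q ^ n) / (1 - q ^ Suc n) * x)) \<longlonglongrightarrow> norm (b * x)"
      using tendsto_norm by fastforce
    then have "eventually (\<lambda>n. norm ((b - a * q ^ n) / (1 - q ^ Suc n) * x) < t) sequentially"
      using t by (intro order_tendstoD)
    then obtain N where N: "\<And>n. n \<ge> N \<Longrightarrow> norm ((b - a * q ^ n) / (1 - q ^ Suc n) * x) < t"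
      unfolding eventually_sequentially by blast
    show ?thesis
    proof (rule summable_ratio_test[OF t(2)])
      fix n assume "N \<le> n"
      have "norm (c (Suc n) * x ^ Suc n) =
          norm ((b - a * q ^ n) / (1 - q ^ Suc n) * x) * norm (c n * x ^ n)"
        unfolding c_Suc by (simp add: norm_mult norm_divide)
      also have "\<dots> \<le> t * norm (c n * x ^ n)"
        using N[OF \<open>N \<le> n\<close>] by (intro mult_right_mono) auto
      finally show "norm (norm (c (Suc n) * x ^ Suc n)) \<le> t * norm (norm (c n * x ^ n))"
        by simp
    qed
  qed
  show "summable (\<lambda>n. norm (c n * z ^ n))"
    by (rule sum[OF bz])
  define F where "F = (\<lambda>x. \<Sum>n. c n * x ^ n)"
  have bq: "norm (b * (x * q ^ n)) < 1" if "norm (b * x) < 1" for x n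
  proof -
    have "norm (b * (x * q ^ n)) = norm (b * x) * norm q ^ n"
      by (simp add: norm_mult norm_power)
    also have "\<dots> \<le> norm (b * x) * 1"
      using q by (intro mult_left_mono power_le_one) auto
    finally show ?thesis
      using that by simp
  qed
  have step: "F x * (1 - b * x) = (1 - a * x) * F (x * q)" if x: "norm (b * x) < 1" for x
  proof -
    have S: "(\<lambda>n. c n * x ^ n) sums F x" "(\<lambda>n. c n * (x * q) ^ n) sums F (x * q)"
      unfolding F_def using sum[OF x] sum[OF bq[OF x, of 1]]
      by (auto intro!: summable_sums intro: summable_norm_cancel)
    have "(\<lambda>n. c n * x ^ n - c n * (x * q) ^ n) sums (F x - F (x * q))"
      by (rule sums_diff[OF S])
    \<comment> \<open>The constant terms of F(x) and F(x q) agree, so the difference starts at n =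
      1, where the recurrence applies.\<close>
    then have "(\<lambda>n. c (Suc n) * x ^ Suc n - c (Suc n) * (x * q) ^ Suc n) sums (F x - F (x * q))"
      by (subst sums_Suc_iff) simp
    moreover have "c (Suc n) * x ^ Suc n - c (Suc n) * (x * q) ^ Suc n =
        b * x * (c n * x ^ n) - a * x * (c n * (x * q) ^ n)" for n
    proof -
      have "c (Suc n) * x ^ Suc n - c (Suc n) * (x * q) ^ Suc n =
          x ^ Suc n * (c (Suc n) * (1 - q ^ Suc n))"
        by (simp add: algebra_simps)
      then show ?thesis
        unfolding rec by (simp add: algebra_simps)
    qed
    ultimately have "(\<lambda>n. b * x * (c n * x ^ n) - a * x * (c n * (x * q) ^ n)) sums (F x - F (x * q))"
      by simp
    moreover have "(\<lambda>n. b * x * (c n * x ^ n) - a * x * (c n * (x * q) ^ n)) sums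
        (b * x * F x - a * x * F (x * q))"
      by (intro sums_diff sums_mult S)
    ultimately have "F x - F (x * q) = b * x * F x - a * x * F (x * q)"
      by (rule sums_unique2)
    then show ?thesis
      by (simp add: algebra_simps)
  qed
  have iter: "F z * qpoch (b * z) q n = qpoch (a * z) q n * F (z * q ^ n)" for n
  proof (induction n)
    case (Suc n)
    have "F z * qpoch (b * z) q (Suc n) = qpoch (a * z) q n * (F (z * q ^ n) * (1 - b * (z * q ^ n)))"
      using Suc by (simp add: qpoch_Suc algebra_simps)
    also have "\<dots> = qpoch (a * z) q (Suc n) * F (z * q ^ Suc n)"
      unfolding step[OF bq[OF bz]] by (simp add: qpoch_Suc algebra_simps)
    finally show ?case .
  qed simp
  \<comment> \<open>Continuity of F at 0 comes from convergence at the nonzero point z; for z = 0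
    the series is its constant term.\<close>
  have "(\<lambda>n. F (z * q ^ n)) \<longlonglongrightarrow> 1"
  proof (cases "z = 0")
    case True
    then show ?thesis
      using powser_zero[of c] \<open>c 0 = 1\<close> by (simp add: F_def)
  next
    case False
    then have "isCont F 0"
      unfolding F_def by (intro isCont_powser[OF summable_norm_cancel[OF sum[OF bz]]]) auto
    moreover have "(\<lambda>n. z * q ^ n) \<longlonglongrightarrow> 0"
      using tendsto_mult_right_zero[OF LIMSEQ_power_zero[OF q]] by blast
    ultimately have "(\<lambda>n. F (z * q ^ n)) \<longlonglongrightarrow> F 0"
      by (rule isCont_tendsto_compose)
    then show ?thesis
      using powser_zero[of c] \<open>c 0 = 1\<close> by (simp add: F_def)
  qed
  then have "(\<lambda>n. F z * qpoch (b * z) q n) \<longlonglongrightarrow> qpoch_inf (a * z) q * 1"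
    unfolding iter by (intro tendsto_mult qpoch_tendsto q)
  moreover have "(\<lambda>n. F z * qpoch (b * z) q n) \<longlonglongrightarrow> F z * qpoch_inf (b * z) q"
    by (intro tendsto_mult qpoch_tendsto q tendsto_const)
  ultimately show "(\<Sum>n. c n * z ^ n) * qpoch_inf (b * z) q = qpoch_inf (a * z) q"
    unfolding F_def using LIMSEQ_unique by auto
qed

lemma q_binomial:
  assumes q: "norm q < 1" and z: "norm z < 1"
  shows "((\<lambda>n. qpoch a q n / qpoch q q n * z ^ n) has_sum
    (qpoch_inf (a * z) q / qpoch_inf z q)) UNIV"
proof -
  let ?c = "\<lambda>n. qpoch a q n / qpoch q q n"
  have rec: "?c (Suc n) * (1 - q ^ Suc n) = (1 - a * q ^ n) * ?c n" for n
    using mult_power_neq_1[OF q q, of n] by (simp add: qpoch_Suc)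
  have S: "summable (\<lambda>n. norm (?c n * z ^ n))"
    and "(\<Sum>n. ?c n * z ^ n) * qpoch_inf z q = qpoch_inf (a * z) q"
    using q_binomial_recurrence[OF q, of ?c 1 a z, OF _ rec] z by simp_all
  then have "(\<Sum>n. ?c n * z ^ n) = qpoch_inf (a * z) q / qpoch_inf z q"
    using qpoch_inf_nonzero'[OF q z] by (simp add: field_simps)
  with S show ?thesis
    by (metis norm_summable_imp_has_sum summable_norm_cancel summable_sums)
qed

lemma euler_sum:
  assumes "norm q < 1" "r\<^sup>2 = q"
  shows "((\<lambda>n. r ^ n\<^sup>2 * z ^ n / qpoch q q n) has_sum qpoch_inf (- (r * z)) q) UNIV"
proof -
  let ?c = "\<lambda>n. r ^ n\<^sup>2 / qpoch q q n"
  have e: "r ^ (Suc n)\<^sup>2 = r ^ n\<^sup>2 * (r * q ^ n)" for n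
  proof -
    have "(Suc n)\<^sup>2 = n\<^sup>2 + (1 + 2 * n)"
      by (simp add: power2_eq_square)
    then show ?thesis
      by (simp only: power_add power_mult assms) simp
  qed
  have rec: "?c (Suc n) * (1 - q ^ Suc n) = (0 - - r * q ^ n) * ?c n" for n
    using mult_power_neq_1[OF assms(1) assms(1), of n] by (simp add: qpoch_Suc e)
  have S: "summable (\<lambda>n. norm (?c n * z ^ n))"
    and "(\<Sum>n. ?c n * z ^ n) * qpoch_inf (0 * z) q = qpoch_inf (- (r * z)) q"
    using q_binomial_recurrence[OF assms(1), of ?c 0 "-r" z, OF _ rec] by simp_all
  moreover have "qpoch_inf 0 q = 1"
    by (simp add: qpoch_inf_def)
  ultimately show ?thesis
    using norm_summable_imp_has_sum[OF S summable_sums[OF summable_norm_cancel[OF S]]]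
    by simp
qed

section \<open>Sums over several indices\<close>

lemma has_sum_geometric:
  fixes x :: complex
  assumes "norm x < 1"
  shows "((\<lambda>n. x ^ n) has_sum (1 / (1 - x))) UNIV"
  using assms by (intro norm_summable_imp_has_sum geometric_sums)
    (simp_all add: norm_power summable_geometric)

lemma summable_on_geometric:
  fixes x :: real
  assumes "0 \<le> x" "x < 1"
  shows "(\<lambda>n. x ^ n) summable_on UNIV"
  using assms by (intro norm_summable_imp_summable_on) (simp add: norm_power summable_geometric)

text \<open>Adjoins one geometric index to a summable family; iterating it gives the product
  majorants for two and three indices.\<close>

lemma summable_on_geometric_mult:
  fixes x :: real and f :: "'a \<Rightarrow> real"
  assumes "0 \<le> x" "x < 1" "f summable_on A" "\<And>a. a \<in> A \<Longrightarrow> f a \<ge> 0"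
  shows "(\<lambda>(n, a). x ^ n * f a) summable_on UNIV \<times> A"
proof (rule summable_on_SigmaI)
  show "((\<lambda>a. case (n, a) of (n, a) \<Rightarrow> x ^ n * f a) has_sum (x ^ n * infsum f A)) A" for n
    using assms by (auto intro!: has_sum_cmult_right)
  show "(\<lambda>n. x ^ n * infsum f A) summable_on UNIV"
    using assms by (intro summable_on_cmult_left summable_on_geometric)
qed (use assms in auto)

text \<open>\<open>has_sum\<close> is unconditional, so the bijection sending (m, n) to (m + n, m)
  regroups the series, and each block is finite.\<close>

lemma has_sum_diagonal:
  fixes f :: "nat \<times> nat \<Rightarrow> complex"
  assumes "(f has_sum S) (UNIV \<times> UNIV)"
  shows "((\<lambda>N. \<Sum>m\<le>N. f (m, N - m)) has_sum S) UNIV"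
proof -
  have "((\<lambda>(N, m). f (m, N - m)) has_sum S) (SIGMA N:UNIV. {..N}) \<longleftrightarrow> (f has_sum S) (UNIV \<times> UNIV)"
    by (rule has_sum_reindex_bij_witness[of _ "\<lambda>(m, n). (m + n, m)" "\<lambda>(N, m). (m, N - m)"]) auto
  with assms have "((\<lambda>(N, m). f (m, N - m)) has_sum S) (SIGMA N:UNIV. {..N})"
    by simp
  then show ?thesis
    by (rule has_sum_SigmaD) (auto intro!: has_sum_finiteI)
qed

lemma has_sum_even_odd:
  fixes f :: "nat \<Rightarrow> complex"
  assumes "((\<lambda>n. f (2 * n)) has_sum a) UNIV" "((\<lambda>n. f (2 * n + 1)) has_sum b) UNIV"
  shows "(f has_sum (a + b)) UNIV"
proof -
  have "(f has_sum a) (range (\<lambda>n. 2 * n))" "(f has_sum b) (range (\<lambda>n. 2 * n + 1))"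
    using assms by (subst has_sum_reindex; simp add: o_def inj_on_def)+
  moreover have "range (\<lambda>n. 2 * n) \<inter> range (\<lambda>n. 2 * n + 1) = ({} :: nat set)"
    by auto presburger
  moreover have "range (\<lambda>n. 2 * n) \<union> range (\<lambda>n. 2 * n + 1) = (UNIV :: nat set)"
    by (auto simp: image_iff) presburger
  ultimately show ?thesis
    using has_sum_Un_disjoint by metis
qed

section \<open>Lambert series\<close>

text \<open>Induction step: $1 - p^{N} = (1 - p^{N-m}) + p^{N-m} (1 - p^m)$ reduces the sum for $N$
  to the sums for $N - 1$ at $a$ and at $ap$.\<close>

lemma qpoch_partial_fractions:
  assumes p: "norm p < 1" and r: "r\<^sup>2 = p" and "\<And>k. a * p ^ k \<noteq> 1"
  shows "(\<Sum>m\<le>N. (-1) ^ m * r ^ (m\<^sup>2 + m) / (qpoch p p m * qpoch p p (N - m) * (1 - a * p ^ m))) =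
    1 / qpoch a p (Suc N)"
  using assms(3)
proof (induction N arbitrary: a)
  case 0
  then show ?case
    by (simp add: qpoch_def)
next
  case (Suc N)
  define g where "g = (\<lambda>a N m. (-1) ^ m * r ^ (m\<^sup>2 + m) / (qpoch p p m * qpoch p p (N - m) * (1 - a * p ^ m)))"
  have nz: "1 - p * p ^ n \<noteq> 0" for n
    using mult_power_neq_1[OF p p, of n] by simp
  have a1: "a * p ^ k \<noteq> 1" for k
    by (rule Suc.prems)
  have a2: "a * p * p ^ k \<noteq> 1" for k
    using a1[of "Suc k"] by (simp add: mult_ac)
  have IH: "(\<Sum>m\<le>N. g b N m) = 1 / qpoch b p (Suc N)" if "\<And>k. b * p ^ k \<noteq> 1" for b
    unfolding g_def by (rule Suc.IH[OF that])
  have "(1 - p ^ Suc N) * (\<Sum>m\<le>Suc N. g a (Suc N) m) =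
      (\<Sum>m\<le>Suc N. (1 - p ^ (Suc N - m)) * g a (Suc N) m + p ^ (Suc N - m) * (1 - p ^ m) * g a (Suc N) m)"
    unfolding sum_distrib_left
  proof (rule sum.cong)
    fix m assume "m \<in> {..Suc N}"
    then have "p ^ Suc N = p ^ (Suc N - m) * p ^ m"
      by (simp flip: power_add)
    then show "(1 - p ^ Suc N) * g a (Suc N) m =
        (1 - p ^ (Suc N - m)) * g a (Suc N) m + p ^ (Suc N - m) * (1 - p ^ m) * g a (Suc N) m"
      by (simp only:) (simp add: algebra_simps)
  qed simp
  also have "\<dots> = (\<Sum>m\<le>Suc N. (1 - p ^ (Suc N - m)) * g a (Suc N) m)
      + (\<Sum>m\<le>Suc N. p ^ (Suc N - m) * (1 - p ^ m) * g a (Suc N) m)"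
    by (rule sum.distrib)
  \<comment> \<open>The term m = N + 1 vanishes; in the others the factor cancels the last factor of
    (p;p)_(N+1-m).\<close>
  also have "(\<Sum>m\<le>Suc N. (1 - p ^ (Suc N - m)) * g a (Suc N) m) = (\<Sum>m\<le>N. g a N m)"
  proof -
    have "(1 - p ^ (Suc N - m)) * g a (Suc N) m = g a N m" if "m \<le> N" for m
      using nz[of "N - m"] that by (simp add: g_def Suc_diff_le qpoch_Suc)
    then show ?thesis
      by simp
  qed
  \<comment> \<open>Here the term m = 0 vanishes. After shifting m by one, a p^(m+1) reads as (a p)
    p^m, which is why the induction leaves \<open>a\<close> arbitrary.\<close>
  also have "(\<Sum>m\<le>Suc N. p ^ (Suc N - m) * (1 - p ^ m) * g a (Suc N) m) =
      (\<Sum>m\<le>N. - (p ^ Suc N) * g (a * p) N m)"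
  proof -
    have "p ^ (N - m) * (1 - p ^ Suc m) * g a (Suc N) (Suc m) = - (p ^ Suc N) * g (a * p) N m"
      if "m \<le> N" for m
    proof -
      have e: "(Suc m)\<^sup>2 + Suc m = (m\<^sup>2 + m) + 2 * Suc m"
        by (simp add: power2_eq_square)
      have "p ^ N = p ^ (N - m) * p ^ m"
        using that by (simp flip: power_add)
      moreover have "r ^ ((Suc m)\<^sup>2 + Suc m) = r ^ (m\<^sup>2 + m) * p ^ Suc m"
        unfolding e power_add[of r "m\<^sup>2 + m"] power_mult r ..
      ultimately show ?thesis
        using nz[of m] unfolding g_def by (simp add: qpoch_Suc mult_ac)
    qed
    then show ?thesis
      by (subst sum.atMost_Suc_shift) simp
  qed
  finally have "(1 - p ^ Suc N) * (\<Sum>m\<le>Suc N. g a (Suc N) m) =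
      1 / qpoch a p (Suc N) - p ^ Suc N * (1 / qpoch (a * p) p (Suc N))"
    unfolding sum_distrib_left[symmetric] IH[OF a1] IH[OF a2] by simp
  \<comment> \<open>Over the common denominator (a;p)_(N+2) the numerator is (1 - a p^(N+1)) -
    p^(N+1) (1 - a) = 1 - p^(N+1).\<close>
  also have "1 / qpoch a p (Suc N) = (1 - a * p ^ Suc N) / qpoch a p (Suc (Suc N))"
    using a1[of "Suc N"] by (simp add: qpoch_Suc)
  also have "1 / qpoch (a * p) p (Suc N) = (1 - a) / qpoch a p (Suc (Suc N))"
    using a1[of 0] by (simp add: qpoch_Suc_left[of a])
  finally have "(1 - p ^ Suc N) * (\<Sum>m\<le>Suc N. g a (Suc N) m) =
      (1 - p ^ Suc N) * (1 / qpoch a p (Suc (Suc N)))"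
    by (simp add: diff_divide_distrib algebra_simps)
  then have "(\<Sum>m\<le>Suc N. g a (Suc N) m) = 1 / qpoch a p (Suc (Suc N))"
    using nz[of N] by (simp only: mult_cancel_left power_Suc simp_thms)
  then show ?case
    by (simp only: g_def)
qed

text \<open>Multiplying \<open>qpoch_partial_fractions\<close> by (a;p)_N z^N writes z^N / (1 - a
  p^N) as a finite sum, so the Lambert series is the antidiagonal sum of a double series in m and n
  = N - m. Summing over n first, by the q-binomial theorem, gives the second series;
  \<open>L\<close> stays unevaluated.\<close>

lemma lambert_transform:
  assumes p: "norm p < 1" and r: "r\<^sup>2 = p" and a: "\<And>k. a * p ^ k \<noteq> 1" and z: "norm z < 1"
  obtains L where "((\<lambda>n. z ^ n / (1 - a * p ^ n)) has_sum L) UNIV"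
    and "((\<lambda>m. (-1) ^ m * r ^ (m\<^sup>2 + m) * qpoch a p m * z ^ m * qpoch_inf (a * z * p ^ m) p
      / (qpoch p p m * (1 - a * p ^ m))) has_sum (qpoch_inf z p * L)) UNIV"
proof -
  define G where "G = (\<lambda>(m, n). qpoch a p (m + n) * (-1) ^ m * r ^ (m\<^sup>2 + m) * z ^ (m + n)
      / (qpoch p p m * qpoch p p n * (1 - a * p ^ m)))"
  have r1: "norm r < 1"
    using p r by (metis norm_power power_less_one_iff norm_ge_zero zero_less_numeral)
  obtain C1 where C1: "C1 > 0" "\<And>n. norm (qpoch a p n) \<le> C1"
    using qpoch_bounded[OF p] by blast
  obtain C2 where C2: "C2 > 0" "\<And>n. norm (inverse (qpoch p p n)) \<le> C2"
    using inverse_qpoch_bounded[OF p p] by blast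
  have "(\<lambda>n. inverse (1 - a * p ^ n)) \<longlonglongrightarrow> inverse (1 - a * 0)"
    by (intro tendsto_intros LIMSEQ_power_zero p) auto
  then obtain C3 where C3: "C3 > 0" "\<And>n. norm (inverse (1 - a * p ^ n)) \<le> C3"
    using Bseq_def convergent_imp_Bseq convergentI by metis
  have "G summable_on UNIV \<times> UNIV"
  proof (rule abs_summable_summable[OF Infinite_Sum.abs_summable_on_comparison_test'])
    show "(\<lambda>x. C1 * C2 * C2 * C3 * (case x of (m, n) \<Rightarrow> norm z ^ m * norm z ^ n)) summable_on
        (UNIV \<times> UNIV :: (nat \<times> nat) set)"
      using z by (intro summable_on_cmult_right summable_on_geometric_mult summable_on_geometric) auto
    fix x :: "nat \<times> nat"
    obtain m n where x: "x = (m, n)"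
      by fastforce
    have "norm (G x) = norm (qpoch a p (m + n)) * norm (inverse (qpoch p p m)) *
        norm (inverse (qpoch p p n)) * norm (inverse (1 - a * p ^ m)) *
        (norm r ^ (m\<^sup>2 + m) * (norm z ^ m * norm z ^ n))"
      by (simp add: G_def x norm_mult norm_power norm_inverse power_add divide_inverse mult_ac)
    also have "\<dots> \<le> C1 * C2 * C2 * C3 * (1 * (norm z ^ m * norm z ^ n))"
      using C1 C2 C3 r1 by (intro mult_mono mult_nonneg_nonneg power_le_one) (auto intro: less_imp_le)
    finally show "norm (G x) \<le> C1 * C2 * C2 * C3 * (case x of (m, n) \<Rightarrow> norm z ^ m * norm z ^ n)"
      by (simp add: x)
  qed
  then obtain L where L: "(G has_sum L) (UNIV \<times> UNIV)"
    by (auto simp: summable_on_def)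
  have "(\<Sum>m\<le>N. G (m, N - m)) = z ^ N / (1 - a * p ^ N)" for N
  proof -
    have "(\<Sum>m\<le>N. G (m, N - m)) = qpoch a p N * z ^ N *
        (\<Sum>m\<le>N. (-1) ^ m * r ^ (m\<^sup>2 + m) / (qpoch p p m * qpoch p p (N - m) * (1 - a * p ^ m)))"
      unfolding sum_distrib_left by (intro sum.cong) (auto simp: G_def)
    also have "\<dots> = z ^ N / (1 - a * p ^ N)"
      unfolding qpoch_partial_fractions[OF p r a] using qpoch_nonzero[OF a] by (simp add: qpoch_Suc)
    finally show ?thesis .
  qed
  with has_sum_diagonal[OF L] have 1: "((\<lambda>n. z ^ n / (1 - a * p ^ n)) has_sum L) UNIV"
    by simp
  define u where "u = (\<lambda>m. (-1) ^ m * r ^ (m\<^sup>2 + m) * qpoch a p m * z ^ m / (qpoch p p m * (1 - a * p ^ m)))"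
  have "((\<lambda>n. G (m, n)) has_sum u m * (qpoch_inf (a * p ^ m * z) p / qpoch_inf z p)) UNIV" for m
  proof -
    have "G (m, n) = u m * (qpoch (a * p ^ m) p n / qpoch p p n * z ^ n)" for n
      by (simp add: G_def u_def qpoch_add power_add mult_ac)
    then show ?thesis
      using has_sum_cmult_right[OF q_binomial[OF p z, of "a * p ^ m"], of "u m"] by simp
  qed
  from has_sum_SigmaD[OF L this]
  have "((\<lambda>m. u m * (qpoch_inf (a * p ^ m * z) p / qpoch_inf z p)) has_sum L) UNIV"
    by simp
  from has_sum_cmult_right[OF this, of "qpoch_inf z p"]
  have "((\<lambda>m. u m * qpoch_inf (a * p ^ m * z) p) has_sum (qpoch_inf z p * L)) UNIV"
    using qpoch_inf_nonzero'[OF p z] by simp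
  then have "((\<lambda>m. (-1) ^ m * r ^ (m\<^sup>2 + m) * qpoch a p m * z ^ m * qpoch_inf (a * z * p ^ m) p
      / (qpoch p p m * (1 - a * p ^ m))) has_sum (qpoch_inf z p * L)) UNIV"
    by (simp add: u_def mult_ac)
  with 1 show ?thesis
    by (rule that)
qed

text \<open>Both series, expanded geometrically, are sums of $\pm q^{(n+1)(2m+1)}$ up to the term $n = 0$ of the first.\<close>

lemma lambert_cancel:
  fixes q :: complex
  assumes q: "norm q < 1"
    and L1: "((\<lambda>n. (- q) ^ n / (1 + (q\<^sup>2) ^ n)) has_sum L1) UNIV"
    and L2: "((\<lambda>n. (- (q\<^sup>2)) ^ n / (1 + q * (q\<^sup>2) ^ n)) has_sum L2) UNIV"
  shows "L1 + q * L2 = 1 / 2"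
proof -
  define H where "H = (\<lambda>(n, m). (-1) ^ (n + m + 1) * q ^ ((n + 1) * (2 * m + 1)))"
  have "H summable_on UNIV \<times> UNIV"
  proof (rule abs_summable_summable[OF Infinite_Sum.abs_summable_on_comparison_test'])
    show "(\<lambda>(m, n). norm q ^ m * norm q ^ n) summable_on (UNIV \<times> UNIV :: (nat \<times> nat) set)"
      using q by (intro summable_on_geometric_mult summable_on_geometric) auto
    fix x :: "nat \<times> nat"
    obtain n m where x: "x = (n, m)"
      by fastforce
    have "norm (H x) = norm q ^ ((n + 1) * (2 * m + 1))"
      by (simp add: H_def x norm_mult norm_power)
    also have "\<dots> \<le> norm q ^ (n + m)"
      using q by (intro power_decreasing) auto
    finally show "norm (H x) \<le> (case x of (m, n) \<Rightarrow> norm q ^ m * norm q ^ n)"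
      by (simp add: x power_add)
  qed
  then obtain S where S: "(H has_sum S) (UNIV \<times> UNIV)"
    by (auto simp: summable_on_def)
  have small: "norm (- (q ^ Suc n)) < 1" for n
    using q by (simp add: norm_power power_less_one_iff del: power_Suc)
  \<comment> \<open>Rows: geometric in m with ratio -q^(2n+2), giving the term of index n + 1 of the
    first series.\<close>
  have "((\<lambda>m. H (n, m)) has_sum ((- q) ^ Suc n / (1 + (q\<^sup>2) ^ Suc n))) UNIV" for n
  proof -
    have "H (n, m) = (- q) ^ Suc n * (- (q ^ Suc (2 * n + 1))) ^ m" for m
    proof -
      have "(n + 1) * (2 * m + 1) = Suc n + Suc (2 * n + 1) * m"
        by (simp add: algebra_simps)
      then have "q ^ ((n + 1) * (2 * m + 1)) = q ^ Suc n * (q ^ Suc (2 * n + 1)) ^ m"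
        by (simp only: power_add power_mult)
      then show ?thesis
        by (simp add: H_def power_add power_minus[of "q ^ _"] power_minus[of q] power_minus[of "q * _"])
    qed
    moreover have "q ^ Suc (2 * n + 1) = (q\<^sup>2) ^ Suc n"
      by (simp only: power_mult[symmetric]) simp
    ultimately show ?thesis
      using has_sum_cmult_right[OF has_sum_geometric[OF small[of "2 * n + 1"]], of "(- q) ^ Suc n"]
      by simp
  qed
  from has_sum_SigmaD[OF S this]
  have "((\<lambda>n. (- q) ^ Suc n / (1 + (q\<^sup>2) ^ Suc n)) has_sum S) UNIV"
    by simp
  then have "(\<lambda>n. (- q) ^ Suc n / (1 + (q\<^sup>2) ^ Suc n)) sums S"
    by (rule has_sum_imp_sums)
  \<comment> \<open>The missing term n = 0 is 1/(1 + 1).\<close>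
  then have "(\<lambda>n. (- q) ^ n / (1 + (q\<^sup>2) ^ n)) sums (S + 1 / 2)"
    by (subst (asm) sums_Suc_iff) simp
  with has_sum_imp_sums[OF L1] have eq1: "L1 = S + 1 / 2"
    by (rule sums_unique2)
  \<comment> \<open>Columns: geometric in n with ratio -q^(2m+1), giving -q times the term of index
    m of the second series. Hence L1 - 1/2 = S = -q L2.\<close>
  have "((\<lambda>n. H (n, m)) has_sum (- q * ((- (q\<^sup>2)) ^ m / (1 + q * (q\<^sup>2) ^ m)))) UNIV" for m
  proof -
    have "H (n, m) = - ((-1) ^ m * q ^ Suc (2 * m)) * (- (q ^ Suc (2 * m))) ^ n" for n
    proof -
      have "(n + 1) * (2 * m + 1) = Suc (2 * m) + Suc (2 * m) * n"
        by (simp add: algebra_simps)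
      then have "q ^ ((n + 1) * (2 * m + 1)) = q ^ Suc (2 * m) * (q ^ Suc (2 * m)) ^ n"
        by (simp only: power_add power_mult)
      then show ?thesis
        by (simp add: H_def power_add power_minus[of "q ^ _"] power_minus[of "q * _"])
    qed
    moreover have "q ^ (m * 2) = (q\<^sup>2) ^ m"
      by (metis mult.commute power_mult)
    moreover have "(- (q\<^sup>2)) ^ m = (-1) ^ m * (q\<^sup>2) ^ m"
      by (rule power_minus)
    ultimately show ?thesis
      using has_sum_cmult_right[OF has_sum_geometric[OF small[of "2 * m"]],
          of "- ((-1) ^ m * q ^ Suc (2 * m))"]
      by (simp add: mult_ac)
  qed
  from has_sum_SigmaD[OF S[unfolded has_sum_swap[of H]], of "\<lambda>m. - q * ((- (q\<^sup>2)) ^ m / (1 + q * (q\<^sup>2) ^ m))"] this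
  have "((\<lambda>m. - q * ((- (q\<^sup>2)) ^ m / (1 + q * (q\<^sup>2) ^ m))) has_sum S) UNIV"
    by simp
  with has_sum_cmult_right[OF L2, of "- q"] have "- q * L2 = S"
    using has_sum_unique by blast
  then have "q * L2 = - S"
    by auto
  then show ?thesis
    using eq1 by simp
qed

section \<open>The triple sums\<close>

text \<open>The linear form is $\alpha i + \beta j + \gamma k$ in powers of $s = q^{1/2}$.\<close>

definition nahm :: "complex \<Rightarrow> int \<Rightarrow> int \<Rightarrow> int \<Rightarrow> nat \<times> nat \<times> nat \<Rightarrow> complex" where
  "nahm s \<alpha> \<beta> \<gamma> = (\<lambda>(i, j, k). s powi (int i ^ 2 + 2 * int j ^ 2 + 2 * int k ^ 2
     - 2 * int i * int k - 2 * int j * int k + \<alpha> * int i + \<beta> * int j + \<gamma> * int k)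
     / (qpoch (s\<^sup>2) (s\<^sup>2) i * qpoch ((s\<^sup>2)\<^sup>2) ((s\<^sup>2)\<^sup>2) j * qpoch ((s\<^sup>2)\<^sup>2) ((s\<^sup>2)\<^sup>2) k))"

text \<open>The quadratic form is $(i-k)^2 + (k-j)^2 + j^2$.\<close>

lemma nahm_exponent_ge:
  fixes i j k \<alpha> \<beta> \<gamma> M :: int
  assumes "\<bar>\<alpha>\<bar> \<le> M" "\<bar>\<beta>\<bar> \<le> M" "\<bar>\<gamma>\<bar> \<le> M" "i \<ge> 0" "j \<ge> 0" "k \<ge> 0"
  shows "i + j + k - 9 * (M + 1)\<^sup>2 \<le>
    i\<^sup>2 + 2 * j\<^sup>2 + 2 * k\<^sup>2 - 2 * i * k - 2 * j * k + \<alpha> * i + \<beta> * j + \<gamma> * k"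
proof -
  define Q where "Q = i\<^sup>2 + 2 * j\<^sup>2 + 2 * k\<^sup>2 - 2 * i * k - 2 * j * k"
  \<comment> \<open>With a = i - k, b = k - j and c = j the left side is (a+b+c)^2 + (b+c)^2 + c^2.
    Bounding each 2xy by x^2 + y^2 gives at most 3a^2 + 5b^2 + 6c^2, hence the constant 6.\<close>
  have Q: "i\<^sup>2 + j\<^sup>2 + k\<^sup>2 \<le> 6 * Q"
  proof -
    have "0 \<le> (2 * (i - k) - (k - j))\<^sup>2" "0 \<le> (2 * (i - k) - j)\<^sup>2" "0 \<le> (2 * (k - j) - j)\<^sup>2"
      "0 \<le> (i - k)\<^sup>2" "0 \<le> (k - j)\<^sup>2" "0 \<le> j\<^sup>2"
      "0 \<le> ((i - k) - (k - j))\<^sup>2" "0 \<le> ((i - k) - j)\<^sup>2" "0 \<le> ((k - j) - j)\<^sup>2"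
      by simp_all
    then show ?thesis
      unfolding Q_def by (simp add: power2_eq_square algebra_simps)
  qed
  \<comment> \<open>Completing the square against 6(M+1)x costs 9(M+1)^2. Of the 6(M+1)x gained, 6Mx
    absorbs the term with c and 6x is left as linear growth.\<close>
  have lin: "6 * x - 9 * (M + 1)\<^sup>2 \<le> x\<^sup>2 + 6 * (c * x)" if "\<bar>c\<bar> \<le> M" "x \<ge> 0" for c x :: int
  proof -
    have "0 \<le> (x - 3 * (M + 1))\<^sup>2"
      by simp
    moreover have "- M * x \<le> c * x"
      using that by (intro mult_right_mono) auto
    ultimately show ?thesis
      by (simp add: power2_eq_square algebra_simps)
  qed
  \<comment> \<open>Three copies of 9(M+1)^2, divided by 6, cost 9/2 (M+1)^2; the claim weakens this
    to the integer 9(M+1)^2.\<close>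
  have "6 * (i + j + k) - 27 * (M + 1)\<^sup>2 \<le> 6 * (Q + \<alpha> * i + \<beta> * j + \<gamma> * k)"
    using lin[of \<alpha> i] lin[of \<beta> j] lin[of \<gamma> k] assms Q by simp
  moreover have "0 \<le> (M + 1)\<^sup>2"
    by simp
  ultimately have "i + j + k - 9 * (M + 1)\<^sup>2 \<le> Q + \<alpha> * i + \<beta> * j + \<gamma> * k"
    unfolding distrib_left by linarith
  then show ?thesis
    by (simp add: Q_def)
qed

text \<open>The exponent may be negative, but by \<open>nahm_exponent_ge\<close> it is at least i +
  j + k minus a constant. \<open>K\<close> absorbs that constant, and since 0 < |s| < 1 a geometric
  majorant remains.\<close>

lemma nahm_summable:
  assumes s: "norm s < 1" "s \<noteq> 0"
  shows "nahm s \<alpha> \<beta> \<gamma> summable_on UNIV"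
proof -
  define M where "M = \<bar>\<alpha>\<bar> + \<bar>\<beta>\<bar> + \<bar>\<gamma>\<bar>"
  define K where "K = norm s powi (- 9 * (M + 1)\<^sup>2)"
  note q = norm_power2_less_1[OF s(1)] norm_power2_less_1[OF norm_power2_less_1[OF s(1)]]
  obtain C1 where C1: "C1 > 0" "\<And>n. norm (inverse (qpoch (s\<^sup>2) (s\<^sup>2) n)) \<le> C1"
    using inverse_qpoch_bounded[OF q(1) q(1)] by blast
  obtain C2 where C2: "C2 > 0" "\<And>n. norm (inverse (qpoch ((s\<^sup>2)\<^sup>2) ((s\<^sup>2)\<^sup>2) n)) \<le> C2"
    using inverse_qpoch_bounded[OF q(2) q(2)] by blast
  have "nahm s \<alpha> \<beta> \<gamma> summable_on UNIV \<times> UNIV \<times> UNIV"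
  proof (rule abs_summable_summable[OF Infinite_Sum.abs_summable_on_comparison_test'])
    show "(\<lambda>x. C1 * C2 * C2 * K * (case x of (i, y) \<Rightarrow> norm s ^ i *
        (case y of (j, k) \<Rightarrow> norm s ^ j * norm s ^ k))) summable_on UNIV \<times> UNIV \<times> UNIV"
      using s by (intro summable_on_cmult_right summable_on_geometric_mult summable_on_geometric)
        auto
    fix x :: "nat \<times> nat \<times> nat"
    obtain i j k where x: "x = (i, j, k)"
      using prod_cases3 by blast
    define e where "e = int i ^ 2 + 2 * int j ^ 2 + 2 * int k ^ 2
      - 2 * int i * int k - 2 * int j * int k + \<alpha> * int i + \<beta> * int j + \<gamma> * int k"
    have "norm s powi e \<le> norm s powi (int i + int j + int k - 9 * (M + 1)\<^sup>2)"
      unfolding e_def using s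
      by (intro power_int_decreasing nahm_exponent_ge) (auto simp: M_def)
    also have "\<dots> = K * (norm s ^ i * (norm s ^ j * norm s ^ k))"
      using s by (simp add: K_def power_int_add power_int_diff power_int_minus field_simps)
    finally have e: "norm s powi e \<le> K * (norm s ^ i * (norm s ^ j * norm s ^ k))" .
    have "nahm s \<alpha> \<beta> \<gamma> x = s powi e / (qpoch (s\<^sup>2) (s\<^sup>2) i * qpoch ((s\<^sup>2)\<^sup>2) ((s\<^sup>2)\<^sup>2) j * qpoch ((s\<^sup>2)\<^sup>2) ((s\<^sup>2)\<^sup>2) k)"
      by (simp only: nahm_def x e_def prod.case)
    then have "norm (nahm s \<alpha> \<beta> \<gamma> x) = norm (inverse (qpoch (s\<^sup>2) (s\<^sup>2) i)) *
        norm (inverse (qpoch ((s\<^sup>2)\<^sup>2) ((s\<^sup>2)\<^sup>2) j)) * norm (inverse (qpoch ((s\<^sup>2)\<^sup>2) ((s\<^sup>2)\<^sup>2) k)) *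
        norm s powi e"
      by (simp add: norm_mult norm_inverse norm_power_int divide_inverse mult_ac)
    also have "\<dots> \<le> C1 * C2 * C2 * (K * (norm s ^ i * (norm s ^ j * norm s ^ k)))"
      using C1 C2 e by (intro mult_mono mult_nonneg_nonneg) (auto intro: less_imp_le)
    finally show "norm (nahm s \<alpha> \<beta> \<gamma> x) \<le> C1 * C2 * C2 * K * (case x of (i, y) \<Rightarrow> norm s ^ i *
        (case y of (j, k) \<Rightarrow> norm s ^ j * norm s ^ k))"
      by (simp add: x mult_ac)
  qed
  then show ?thesis
    by simp
qed

section \<open>Summation over one index at a time\<close>

lemma euler_sum_powi:
  assumes "norm (s\<^sup>2) < 1" "s \<noteq> 0"
  shows "((\<lambda>n. s powi (int n ^ 2 + c * int n) / qpoch (s\<^sup>2) (s\<^sup>2) n) has_sum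
    qpoch_inf (- (s powi (1 + c))) (s\<^sup>2)) UNIV"
proof -
  have "s powi (int n ^ 2 + c * int n) = s ^ n\<^sup>2 * (s powi c) ^ n" for n
  proof -
    have "s powi (int n ^ 2) = s ^ n\<^sup>2"
      by (metis of_nat_power power_int_of_nat)
    then show ?thesis
      using assms by (simp add: power_int_add power_int_mult)
  qed
  moreover have "s powi (1 + c) = s * s powi c"
    using assms by (simp add: power_int_add)
  ultimately show ?thesis
    using euler_sum[OF assms(1) refl, of "s powi c"] by simp
qed

text \<open>For fixed j and k the exponent is i^2 plus a linear term in i with coefficient \<alpha>
  - 2k, so Euler's identity applies once i is made the inner index.\<close>

lemma nahm_sum_first:
  assumes s: "norm s < 1" "s \<noteq> 0" and S: "(nahm s \<alpha> \<beta> \<gamma> has_sum S) UNIV"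
  shows "((\<lambda>(j, k). s powi (2 * int j ^ 2 + 2 * int k ^ 2 - 2 * int j * int k + \<beta> * int j + \<gamma> * int k)
      / (qpoch ((s\<^sup>2)\<^sup>2) ((s\<^sup>2)\<^sup>2) j * qpoch ((s\<^sup>2)\<^sup>2) ((s\<^sup>2)\<^sup>2) k)
      * qpoch_inf (- (s powi (1 + \<alpha> - 2 * int k))) (s\<^sup>2)) has_sum S) (UNIV \<times> UNIV)"
proof -
  have "(nahm s \<alpha> \<beta> \<gamma> has_sum S) (UNIV \<times> (UNIV \<times> UNIV))"
    using S by simp
  then have "((\<lambda>(jk, i). nahm s \<alpha> \<beta> \<gamma> (i, jk)) has_sum S) ((UNIV \<times> UNIV) \<times> UNIV)"
    by (subst (asm) has_sum_swap)
  then show ?thesis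
  proof (rule has_sum_SigmaD)
    fix jk :: "nat \<times> nat"
    obtain j k where jk: "jk = (j, k)"
      by fastforce
    define d where "d = 2 * int j ^ 2 + 2 * int k ^ 2 - 2 * int j * int k + \<beta> * int j + \<gamma> * int k"
    define D where "D = qpoch ((s\<^sup>2)\<^sup>2) ((s\<^sup>2)\<^sup>2) j * qpoch ((s\<^sup>2)\<^sup>2) ((s\<^sup>2)\<^sup>2) k"
    have "nahm s \<alpha> \<beta> \<gamma> (i, j, k) =
        s powi d / D * (s powi (int i ^ 2 + (\<alpha> - 2 * int k) * int i) / qpoch (s\<^sup>2) (s\<^sup>2) i)" for i
    proof -
      have "int i ^ 2 + 2 * int j ^ 2 + 2 * int k ^ 2 - 2 * int i * int k - 2 * int j * int k
          + \<alpha> * int i + \<beta> * int j + \<gamma> * int k = d + (int i ^ 2 + (\<alpha> - 2 * int k) * int i)"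
        by (simp add: d_def algebra_simps)
      then have "nahm s \<alpha> \<beta> \<gamma> (i, j, k) =
          s powi (d + (int i ^ 2 + (\<alpha> - 2 * int k) * int i)) / (qpoch (s\<^sup>2) (s\<^sup>2) i * D)"
        by (simp only: nahm_def D_def mult.assoc prod.case)
      then show ?thesis
        using s by (simp add: power_int_add mult_ac)
    qed
    then show "((\<lambda>i. case (jk, i) of (jk, i) \<Rightarrow> nahm s \<alpha> \<beta> \<gamma> (i, jk)) has_sum
        (case jk of (j, k) \<Rightarrow> s powi (2 * int j ^ 2 + 2 * int k ^ 2 - 2 * int j * int k + \<beta> * int j + \<gamma> * int k)
          / (qpoch ((s\<^sup>2)\<^sup>2) ((s\<^sup>2)\<^sup>2) j * qpoch ((s\<^sup>2)\<^sup>2) ((s\<^sup>2)\<^sup>2) k)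
          * qpoch_inf (- (s powi (1 + \<alpha> - 2 * int k))) (s\<^sup>2))) UNIV"
      using has_sum_cmult_right[OF euler_sum_powi[OF norm_power2_less_1[OF s(1)] s(2), of "\<alpha> - 2 * int k"],
          of "s powi d / D"]
      by (simp add: jk d_def D_def add_diff_eq)
  qed
qed

text \<open>This is \<open>qpoch_inf_shift_neg\<close> at c = 1; the 2 is the first factor of
  (-1;q)_\<infinity>.\<close>

lemma qpoch_inf_neg_power:
  assumes s: "norm s < 1" "s \<noteq> 0"
  shows "qpoch_inf (- (s powi (- 2 * int k))) (s\<^sup>2) =
    2 * qpoch_inf (- (s\<^sup>2)) (s\<^sup>2) * qpoch (- (s\<^sup>2)) (s\<^sup>2) k * s powi (- (int k ^ 2 + int k))"
proof -
  have q: "norm (s\<^sup>2) < 1"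
    using s by (intro norm_power2_less_1)
  have E1: "s powi (- 2 * int k) = 1 / (s\<^sup>2) ^ k"
    using s by (simp add: power_int_minus power_int_mult divide_inverse)
  have E2: "s powi (- (int k ^ 2 + int k)) = inverse (s ^ (k\<^sup>2 + k))"
    unfolding power_int_minus by (metis of_nat_add of_nat_power power_int_of_nat)
  have "qpoch_inf (- 1) (s\<^sup>2) = 2 * qpoch_inf (- (s\<^sup>2)) (s\<^sup>2)"
    using qpoch_inf_Suc[OF q, of "- 1"] by simp
  then show ?thesis
    unfolding E1 E2 using qpoch_inf_shift_neg[OF q refl s(2), of 1 k] s by (simp add: field_simps)
qed

text \<open>The sums over i and k each contribute 2P and reduce one denominator from base q^2 to
  base q, which prepares the next Euler sum; the last one, over j, has linear coefficient \<beta> -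
  1. The first identity uses \<beta> = -1, the sum T uses \<beta> = 2.\<close>

lemma has_sum_nahm_minus_1:
  assumes s: "norm s < 1" "s \<noteq> 0"
  shows "(nahm s (- 1) \<beta> 0 has_sum
    (4 * qpoch_inf (- (s\<^sup>2)) (s\<^sup>2) ^ 2 * qpoch_inf (- (s powi \<beta>)) (s\<^sup>2))) UNIV"
proof -
  define q where "q = s\<^sup>2"
  define P where "P = qpoch_inf (- q) q"
  have q: "norm q < 1"
    unfolding q_def using s by (intro norm_power2_less_1)
  have dbl: "qpoch (q\<^sup>2) (q\<^sup>2) k = qpoch q q k * qpoch (- q) q k" for k
    by (simp add: qpoch_mult_neg)
  have nz: "qpoch (- q) q k \<noteq> 0" for k
    using q by (intro qpoch_nonzero') auto
  have theta: "qpoch_inf (- (s powi (- 2 * int k))) q =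
      2 * P * qpoch (- q) q k * s powi (- (int k ^ 2 + int k))" for k
    using qpoch_inf_neg_power[OF s] by (simp add: q_def P_def)
  obtain S where S: "(nahm s (- 1) \<beta> 0 has_sum S) UNIV"
    using nahm_summable[OF s] unfolding summable_on_def by blast
  have "s powi (2 * int j ^ 2 + 2 * int k ^ 2 - 2 * int j * int k + \<beta> * int j + 0 * int k)
      / (qpoch (q\<^sup>2) (q\<^sup>2) j * qpoch (q\<^sup>2) (q\<^sup>2) k) * qpoch_inf (- (s powi (1 + - 1 - 2 * int k))) q
    = 2 * P * s powi (2 * int j ^ 2 + \<beta> * int j) / qpoch (q\<^sup>2) (q\<^sup>2) j
      * (s powi (int k ^ 2 + (- 1 - 2 * int j) * int k) / qpoch q q k)" for j k
  proof -
    \<comment> \<open>The factor q^(-k(k+1)/2) turns 2k^2 into k^2 - k, as Euler's identity in base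
      q requires.\<close>
    have "2 * int j ^ 2 + 2 * int k ^ 2 - 2 * int j * int k + \<beta> * int j + 0 * int k + - (int k ^ 2 + int k)
        = (2 * int j ^ 2 + \<beta> * int j) + (int k ^ 2 + (- 1 - 2 * int j) * int k)"
      by (simp add: algebra_simps)
    then have "s powi (2 * int j ^ 2 + 2 * int k ^ 2 - 2 * int j * int k + \<beta> * int j + 0 * int k)
          * s powi (- (int k ^ 2 + int k)) =
        s powi (2 * int j ^ 2 + \<beta> * int j) * s powi (int k ^ 2 + (- 1 - 2 * int j) * int k)"
      using s by (metis power_int_add)
    then show ?thesis
      using theta[of k] nz[of k] by (simp add: dbl[of k])
  qed
  with nahm_sum_first[OF s S] have
    "((\<lambda>(j, k). 2 * P * s powi (2 * int j ^ 2 + \<beta> * int j) / qpoch (q\<^sup>2) (q\<^sup>2) j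
      * (s powi (int k ^ 2 + (- 1 - 2 * int j) * int k) / qpoch q q k)) has_sum S) (UNIV \<times> UNIV)"
    by (simp add: q_def[symmetric])
  then have "((\<lambda>j. 2 * P * s powi (2 * int j ^ 2 + \<beta> * int j) / qpoch (q\<^sup>2) (q\<^sup>2) j
      * qpoch_inf (- (s powi (- 2 * int j))) q) has_sum S) UNIV"
  proof (rule has_sum_SigmaD)
    fix j
    show "((\<lambda>k. case (j, k) of (j, k) \<Rightarrow> 2 * P * s powi (2 * int j ^ 2 + \<beta> * int j) / qpoch (q\<^sup>2) (q\<^sup>2) j
      * (s powi (int k ^ 2 + (- 1 - 2 * int j) * int k) / qpoch q q k)) has_sum
      (2 * P * s powi (2 * int j ^ 2 + \<beta> * int j) / qpoch (q\<^sup>2) (q\<^sup>2) j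
      * qpoch_inf (- (s powi (- 2 * int j))) q)) UNIV"
      using has_sum_cmult_right[OF euler_sum_powi[OF q[unfolded q_def] s(2), of "- 1 - 2 * int j"],
          of "2 * P * s powi (2 * int j ^ 2 + \<beta> * int j) / qpoch (q\<^sup>2) (q\<^sup>2) j"]
      by (simp add: q_def)
  qed
  moreover have "2 * P * s powi (2 * int j ^ 2 + \<beta> * int j) / qpoch (q\<^sup>2) (q\<^sup>2) j
      * qpoch_inf (- (s powi (- 2 * int j))) q =
      4 * P\<^sup>2 * (s powi (int j ^ 2 + (\<beta> - 1) * int j) / qpoch q q j)" for j
  proof -
    have "2 * int j ^ 2 + \<beta> * int j + - (int j ^ 2 + int j) = int j ^ 2 + (\<beta> - 1) * int j"
      by (simp add: algebra_simps)
    then have eq: "s powi (2 * int j ^ 2 + \<beta> * int j) * s powi (- (int j ^ 2 + int j)) =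
        s powi (int j ^ 2 + (\<beta> - 1) * int j)"
      using s by (metis power_int_add)
    show ?thesis
      unfolding theta dbl eq[symmetric] power2_eq_square[of P] using nz[of j] by simp
  qed
  ultimately have "((\<lambda>j. 4 * P\<^sup>2 * (s powi (int j ^ 2 + (\<beta> - 1) * int j) / qpoch q q j)) has_sum S) UNIV"
    by simp
  moreover have "((\<lambda>j. 4 * P\<^sup>2 * (s powi (int j ^ 2 + (\<beta> - 1) * int j) / qpoch q q j)) has_sum
      (4 * P\<^sup>2 * qpoch_inf (- (s powi \<beta>)) q)) UNIV"
    using has_sum_cmult_right[OF euler_sum_powi[OF q[unfolded q_def] s(2), of "\<beta> - 1"], of "4 * P\<^sup>2"]
    by (simp add: q_def)
  ultimately have "S = 4 * P\<^sup>2 * qpoch_inf (- (s powi \<beta>)) q"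
    by (rule has_sum_unique)
  with S show ?thesis
    by (simp add: P_def q_def)
qed

text \<open>The sum over i gives (-q^(1-k);q)_\<infinity>, so 1 + q^k enters the denominator; the
  sum over j, in base q^2, gives (-q^(2-k);q^2)_\<infinity>. Which fixed product that shifts to
  depends on the parity of k, and each parity class is a transformed Lambert series.\<close>

lemma has_sum_nahm_1_2_0:
  assumes s: "norm s < 1" "s \<noteq> 0"
  shows "(nahm s 1 2 0 has_sum (qpoch_inf (- (s\<^sup>2)) (s\<^sup>2) ^ 3)) UNIV"
proof -
  define q where "q = s\<^sup>2"
  define P where "P = qpoch_inf (- q) q"
  note q = norm_power2_less_1[OF s(1), folded q_def]
    norm_power2_less_1[OF norm_power2_less_1[OF s(1)], folded q_def]
  have q0: "q \<noteq> 0"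
    using s by (simp add: q_def)
  have dbl: "qpoch (q\<^sup>2) (q\<^sup>2) k = qpoch q q k * qpoch (- q) q k" for k
    by (simp add: qpoch_mult_neg)
  have nz: "qpoch (- q) q k \<noteq> 0" for k
    using q by (intro qpoch_nonzero') auto
  have nz1: "1 + q ^ k \<noteq> 0" for k
  proof (cases k)
    case (Suc n)
    have "- q * q ^ n \<noteq> 1"
      using mult_power_neq_1[OF q(1), of "- q" n] q by simp
    then show ?thesis
      unfolding Suc by (metis add_eq_0_iff minus_mult_left minus_minus power_Suc)
  qed simp
  \<comment> \<open>(-q^(-k);q)_\<infinity> is known; its first factor 1 + q^(-k) is divided out,
    and multiplying by q^k turns that factor into 1 + q^k.\<close>
  have theta: "qpoch_inf (- (s powi (2 - 2 * int k))) q =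
      2 * P * qpoch (- q) q k * s powi (int k - int k ^ 2) / (1 + q ^ k)" for k
  proof -
    have "s powi (- 2 * int k) = inverse (q ^ k)"
      using s by (simp add: power_int_minus power_int_mult q_def)
    moreover have "s powi (2 - 2 * int k) = s powi (- 2 * int k) * q"
      using s by (simp add: power_int_diff power_int_minus divide_inverse q_def)
    ultimately have a1: "qpoch_inf (- inverse (q ^ k)) q =
        (1 + inverse (q ^ k)) * qpoch_inf (- (s powi (2 - 2 * int k))) q"
      using qpoch_inf_Suc[OF q(1), of "- inverse (q ^ k)"] by simp
    have a2: "qpoch_inf (- inverse (q ^ k)) q =
        2 * P * qpoch (- q) q k * s powi (- (int k ^ 2 + int k))"
      using qpoch_inf_neg_power[OF s, of k] \<open>s powi (- 2 * int k) = inverse (q ^ k)\<close>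
      by (simp add: q_def P_def)
    have a3: "s powi (- (int k ^ 2 + int k)) * q ^ k = s powi (int k - int k ^ 2)"
    proof -
      have "q ^ k = s powi (2 * int k)"
        using s by (simp add: power_int_mult q_def)
      then have "s powi (- (int k ^ 2 + int k)) * q ^ k = s powi (- (int k ^ 2 + int k) + 2 * int k)"
        using s by (metis power_int_add)
      then show ?thesis
        by simp
    qed
    have "(1 + inverse (q ^ k)) * qpoch_inf (- (s powi (2 - 2 * int k))) q * q ^ k =
        2 * P * qpoch (- q) q k * s powi (int k - int k ^ 2)"
      unfolding a1[symmetric] a2 a3[symmetric] by (rule mult.assoc)
    moreover have "(1 + inverse (q ^ k)) * qpoch_inf (- (s powi (2 - 2 * int k))) q * q ^ k =
        (1 + q ^ k) * qpoch_inf (- (s powi (2 - 2 * int k))) q"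
      using q0 by (simp add: field_simps)
    ultimately show ?thesis
      using nz1[of k] by (simp add: field_simps)
  qed
  obtain S where S: "(nahm s 1 2 0 has_sum S) UNIV"
    using nahm_summable[OF s] unfolding summable_on_def by blast
  \<comment> \<open>\<open>h k\<close> is what remains after the sums over i and j.\<close>
  define h where "h = (\<lambda>k. 2 * P * s ^ (k\<^sup>2 + k) / (qpoch q q k * (1 + q ^ k))
    * qpoch_inf (- (s powi (4 - 2 * int k))) (q\<^sup>2))"
  have "s powi (2 * int j ^ 2 + 2 * int k ^ 2 - 2 * int j * int k + 2 * int j + 0 * int k)
      / (qpoch (q\<^sup>2) (q\<^sup>2) j * qpoch (q\<^sup>2) (q\<^sup>2) k) * qpoch_inf (- (s powi (1 + 1 - 2 * int k))) q
    = 2 * P * s ^ (k\<^sup>2 + k) / (qpoch q q k * (1 + q ^ k))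
      * (q ^ j\<^sup>2 * (s powi (2 - 2 * int k)) ^ j / qpoch (q\<^sup>2) (q\<^sup>2) j)" for j k
  proof -
    have "2 * int j ^ 2 + 2 * int k ^ 2 - 2 * int j * int k + 2 * int j + 0 * int k + (int k - int k ^ 2)
        = int (k\<^sup>2 + k) + (2 * int (j\<^sup>2) + (2 - 2 * int k) * int j)"
      by (simp add: algebra_simps)
    then have "s powi (2 * int j ^ 2 + 2 * int k ^ 2 - 2 * int j * int k + 2 * int j + 0 * int k)
          * s powi (int k - int k ^ 2) =
        s powi (int (k\<^sup>2 + k) + (2 * int (j\<^sup>2) + (2 - 2 * int k) * int j))"
      using s by (metis power_int_add)
    also have "\<dots> = s ^ (k\<^sup>2 + k) * (q ^ j\<^sup>2 * (s powi (2 - 2 * int k)) ^ j)"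
    proof -
      have "s powi (2 * int (j\<^sup>2)) = q ^ j\<^sup>2"
        using s by (simp add: power_int_mult q_def del: of_nat_power)
      moreover have "s powi ((2 - 2 * int k) * int j) = (s powi (2 - 2 * int k)) ^ j"
        using s by (simp add: power_int_mult)
      ultimately show ?thesis
        using s by (simp only: power_int_add power_int_of_nat simp_thms)
    qed
    finally have eq: "s powi (2 * int j ^ 2 + 2 * int k ^ 2 - 2 * int j * int k + 2 * int j + 0 * int k)
        * s powi (int k - int k ^ 2) = s ^ (k\<^sup>2 + k) * (q ^ j\<^sup>2 * (s powi (2 - 2 * int k)) ^ j)" .
    have "s powi (2 * int j ^ 2 + 2 * int k ^ 2 - 2 * int j * int k + 2 * int j + 0 * int k)
        / (qpoch (q\<^sup>2) (q\<^sup>2) j * qpoch (q\<^sup>2) (q\<^sup>2) k) * qpoch_inf (- (s powi (1 + 1 - 2 * int k))) q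
      = 2 * P * (s powi (2 * int j ^ 2 + 2 * int k ^ 2 - 2 * int j * int k + 2 * int j + 0 * int k)
          * s powi (int k - int k ^ 2)) / (qpoch (q\<^sup>2) (q\<^sup>2) j * qpoch q q k * (1 + q ^ k))"
      using theta[of k] nz[of k] by (simp add: dbl[of k])
    then show ?thesis
      unfolding eq by (simp add: mult_ac)
  qed
  with nahm_sum_first[OF s S] have
    "((\<lambda>(j, k). 2 * P * s ^ (k\<^sup>2 + k) / (qpoch q q k * (1 + q ^ k))
      * (q ^ j\<^sup>2 * (s powi (2 - 2 * int k)) ^ j / qpoch (q\<^sup>2) (q\<^sup>2) j)) has_sum S) (UNIV \<times> UNIV)"
    by (simp add: q_def[symmetric])
  then have "((\<lambda>(k, j). 2 * P * s ^ (k\<^sup>2 + k) / (qpoch q q k * (1 + q ^ k))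
      * (q ^ j\<^sup>2 * (s powi (2 - 2 * int k)) ^ j / qpoch (q\<^sup>2) (q\<^sup>2) j)) has_sum S) (UNIV \<times> UNIV)"
    by (subst (asm) has_sum_swap) (simp add: case_prod_unfold)
  then have hS: "(h has_sum S) UNIV"
  proof (rule has_sum_SigmaD)
    fix k
    have "q * s powi (2 - 2 * int k) = s powi (4 - 2 * int k)"
    proof -
      have "s powi (4 - 2 * int k) = s powi (2 + (2 - 2 * int k))"
        by simp
      also have "\<dots> = s powi 2 * s powi (2 - 2 * int k)"
        using s by (intro power_int_add) auto
      finally show ?thesis
        by (simp add: q_def)
    qed
    then show "((\<lambda>j. case (k, j) of (k, j) \<Rightarrow> 2 * P * s ^ (k\<^sup>2 + k) / (qpoch q q k * (1 + q ^ k))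
      * (q ^ j\<^sup>2 * (s powi (2 - 2 * int k)) ^ j / qpoch (q\<^sup>2) (q\<^sup>2) j)) has_sum h k) UNIV"
      using has_sum_cmult_right[OF euler_sum[OF q(2) refl, of "s powi (2 - 2 * int k)"],
          of "2 * P * s ^ (k\<^sup>2 + k) / (qpoch q q k * (1 + q ^ k))"]
      by (simp add: h_def)
  qed
  \<comment> \<open>\<open>R\<close> is the reciprocal of \<open>P\<close>, so splitting
    \<open>R\<close> after m factors turns the reciprocal of (q;q^2)_m into \<open>P\<close> times a
    tail product.\<close>
  define A B R where "A = qpoch_inf (- (q\<^sup>2)) (q\<^sup>2)" and "B = qpoch_inf (- q) (q\<^sup>2)"
    and "R = qpoch_inf q (q\<^sup>2)"
  have P: "P = B * A"
    using qpoch_inf_double[OF q(1), of "- q"] by (simp add: P_def A_def B_def power2_eq_square)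
  have RP: "R * P = 1"
    using euler_odd_distinct[OF q(1)] by (simp add: R_def P_def)
  have R_split: "R = qpoch q (q\<^sup>2) m * qpoch_inf (q * (q\<^sup>2) ^ m) (q\<^sup>2)" for m
    unfolding R_def by (rule qpoch_inf_split[OF q(2)])
  have qq: "(q\<^sup>2) ^ m = q ^ (2 * m)" for m
    by (simp add: power_mult)
  have neg: "- x \<noteq> 1" if "1 + x \<noteq> 0" for x :: complex
    using that by (metis add.left_inverse)
  have ne_even: "- 1 * (q\<^sup>2) ^ k \<noteq> 1" and ne_odd: "- q * (q\<^sup>2) ^ k \<noteq> 1" for k
    using neg[OF nz1[of "2 * k"]] neg[OF nz1[of "2 * k + 1"]] by (simp_all add: qq)
  \<comment> \<open>Parameters for k = 2m in base q^2: 1 + q^k = 1 - a q^(2m) requires a = -1, and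
    the tail (q^(2m+1);q^2)_\<infinity> requires a z = q, so z = -q.\<close>
  obtain L1 where L1: "((\<lambda>n. (- q) ^ n / (1 - (- 1) * (q\<^sup>2) ^ n)) has_sum L1) UNIV"
    and J1: "((\<lambda>m. (-1) ^ m * q ^ (m\<^sup>2 + m) * qpoch (- 1) (q\<^sup>2) m * (- q) ^ m *
      qpoch_inf (- 1 * (- q) * (q\<^sup>2) ^ m) (q\<^sup>2) / (qpoch (q\<^sup>2) (q\<^sup>2) m * (1 - (- 1) * (q\<^sup>2) ^ m)))
      has_sum (qpoch_inf (- q) (q\<^sup>2) * L1)) UNIV"
    by (rule lambert_transform[OF q(2) refl ne_even, of "- q"]) (use q in simp, rule that)
  \<comment> \<open>For k = 2m + 1 likewise a = -q and a z = q^3, so z = -q^2.\<close>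
  obtain L2 where L2: "((\<lambda>n. (- (q\<^sup>2)) ^ n / (1 - (- q) * (q\<^sup>2) ^ n)) has_sum L2) UNIV"
    and J2: "((\<lambda>m. (-1) ^ m * q ^ (m\<^sup>2 + m) * qpoch (- q) (q\<^sup>2) m * (- (q\<^sup>2)) ^ m *
      qpoch_inf (- q * (- (q\<^sup>2)) * (q\<^sup>2) ^ m) (q\<^sup>2) / (qpoch (q\<^sup>2) (q\<^sup>2) m * (1 - (- q) * (q\<^sup>2) ^ m)))
      has_sum (qpoch_inf (- (q\<^sup>2)) (q\<^sup>2) * L2)) UNIV"
    by (rule lambert_transform[OF q(2) refl ne_odd, of "- (q\<^sup>2)"])
      (use q in \<open>simp only: norm_minus_cancel\<close>, rule that)
  have "L1 + q * L2 = 1 / 2"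
    using lambert_cancel[OF q(1)] L1 L2 by simp
  have "h (2 * m) = 2 * P\<^sup>2 * A * ((-1) ^ m * q ^ (m\<^sup>2 + m) * qpoch (- 1) (q\<^sup>2) m * (- q) ^ m *
      qpoch_inf (- 1 * (- q) * (q\<^sup>2) ^ m) (q\<^sup>2) / (qpoch (q\<^sup>2) (q\<^sup>2) m * (1 - (- 1) * (q\<^sup>2) ^ m)))" for m
  proof -
    define W V where "W = qpoch (q\<^sup>2) (q\<^sup>2) m" and "V = qpoch_inf (q * (q\<^sup>2) ^ m) (q\<^sup>2)"
    have "s powi (4 - 2 * int (2 * m)) = q\<^sup>2 / (q\<^sup>2) ^ m"
      using s by (simp add: power_int_diff power_int_mult q_def flip: power_mult)
    \<comment> \<open>The factor q^(m^2+m) is kept apart because \<open>qpoch_inf_shift_neg\<close>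
      consumes it.\<close>
    moreover have "s ^ ((2 * m)\<^sup>2 + 2 * m) = q ^ m\<^sup>2 * q ^ (m\<^sup>2 + m)"
    proof -
      have "(2 * m)\<^sup>2 + 2 * m = 2 * (m\<^sup>2 + (m\<^sup>2 + m))"
        by (simp add: power2_eq_square)
      then show ?thesis
        by (simp only: power_mult q_def power_add)
    qed
    ultimately have "h (2 * m) = 2 * P * q ^ m\<^sup>2 *
        (qpoch_inf (- (q\<^sup>2 / (q\<^sup>2) ^ m)) (q\<^sup>2) * q ^ (m\<^sup>2 + m)) * inverse (qpoch q q (2 * m)) / (1 + q ^ (2 * m))"
      by (simp only: h_def divide_inverse inverse_mult_distrib mult_ac)
    \<comment> \<open>Shift with c = q^2: then p/c = 1 yields (-1;q^2)_m.\<close>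
    also have "qpoch_inf (- (q\<^sup>2 / (q\<^sup>2) ^ m)) (q\<^sup>2) * q ^ (m\<^sup>2 + m) = (q\<^sup>2) ^ m * qpoch (- 1) (q\<^sup>2) m * A"
      using qpoch_inf_shift_neg[OF q(2) refl q0, of "q\<^sup>2" m] q0 by (simp only: A_def) simp
    also have "inverse (qpoch q q (2 * m)) = P * V / W"
    proof -
      have "P * (qpoch q (q\<^sup>2) m * V) = 1"
        using RP R_split[of m] by (simp add: V_def mult.commute)
      then have "inverse (qpoch q (q\<^sup>2) m) = P * V"
        by (intro inverse_unique) (simp add: mult_ac)
      then show ?thesis
        using qpoch_double[of q q m] by (simp add: W_def power2_eq_square divide_inverse)
    qed
    also have "2 * P * q ^ m\<^sup>2 * ((q\<^sup>2) ^ m * qpoch (- 1) (q\<^sup>2) m * A) * (P * V / W) / (1 + q ^ (2 * m)) =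
      2 * P\<^sup>2 * A * ((-1) ^ m * q ^ (m\<^sup>2 + m) * qpoch (- 1) (q\<^sup>2) m * (- q) ^ m * V / (W * (1 + q ^ (2 * m))))"
    proof -
      have "(-1) ^ m * q ^ (m\<^sup>2 + m) * (- q) ^ m = q ^ m\<^sup>2 * (q\<^sup>2) ^ m"
        by (simp add: power_add power2_eq_square power_mult_distrib power_minus[of q])
      then show ?thesis
        by (simp add: power2_eq_square mult_ac)
    qed
    finally show ?thesis
      by (simp add: V_def W_def qq)
  qed
  then have even: "((\<lambda>m. h (2 * m)) has_sum (2 * P\<^sup>2 * A * (B * L1))) UNIV"
    using has_sum_cmult_right[OF J1, of "2 * P\<^sup>2 * A"] by (simp add: B_def)
  have "h (2 * m + 1) = 2 * P\<^sup>2 * q * B * ((-1) ^ m * q ^ (m\<^sup>2 + m) * qpoch (- q) (q\<^sup>2) m * (- (q\<^sup>2)) ^ m *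
      qpoch_inf (- q * (- (q\<^sup>2)) * (q\<^sup>2) ^ m) (q\<^sup>2) / (qpoch (q\<^sup>2) (q\<^sup>2) m * (1 - (- q) * (q\<^sup>2) ^ m)))" for m
  proof -
    define W V where "W = qpoch (q\<^sup>2) (q\<^sup>2) m" and "V = qpoch_inf (q * (q\<^sup>2) ^ Suc m) (q\<^sup>2)"
    have "s powi (4 - 2 * int (2 * m + 1)) = q / (q\<^sup>2) ^ m"
    proof -
      have "s powi (4 - 2 * int (2 * m + 1)) = s powi (2 - int (4 * m))"
        by (simp add: algebra_simps)
      also have "\<dots> = s powi 2 / s powi (int (4 * m))"
        using s by (intro power_int_diff) auto
      also have "s powi (int (4 * m)) = (q\<^sup>2) ^ m"
        unfolding power_int_of_nat by (simp add: power_mult q_def)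
      finally show ?thesis
        by (simp add: q_def)
    qed
    moreover have "s ^ ((2 * m + 1)\<^sup>2 + (2 * m + 1)) = q ^ m\<^sup>2 * (q\<^sup>2) ^ m * q * q ^ (m\<^sup>2 + m)"
    proof -
      have "(2 * m + 1)\<^sup>2 + (2 * m + 1) = 2 * (m\<^sup>2 + 2 * m + 1 + (m\<^sup>2 + m))"
        by (simp add: power2_eq_square)
      then show ?thesis
        by (simp only: power_mult q_def power_add power_one_right)
    qed
    ultimately have "h (2 * m + 1) = 2 * P * (q ^ m\<^sup>2 * (q\<^sup>2) ^ m * q) *
        (qpoch_inf (- (q / (q\<^sup>2) ^ m)) (q\<^sup>2) * q ^ (m\<^sup>2 + m)) * inverse (qpoch q q (2 * m + 1)) / (1 + q ^ (2 * m + 1))"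
      by (simp only: h_def divide_inverse inverse_mult_distrib mult_ac)
    \<comment> \<open>Shift with c = q: then p/c = q yields (-q;q^2)_m, and the fixed product is
      \<open>B\<close> instead of \<open>A\<close>.\<close>
    also have "qpoch_inf (- (q / (q\<^sup>2) ^ m)) (q\<^sup>2) * q ^ (m\<^sup>2 + m) = q ^ m * qpoch (- q) (q\<^sup>2) m * B"
      using qpoch_inf_shift_neg[OF q(2) refl q0 q0, of m] q0 by (simp add: B_def power2_eq_square)
    also have "inverse (qpoch q q (2 * m + 1)) = P * V / W"
    proof -
      have "P * (qpoch q (q\<^sup>2) (Suc m) * V) = 1"
        using RP R_split[of "Suc m"] by (simp add: V_def mult.commute)
      then have "inverse (qpoch q (q\<^sup>2) (Suc m)) = P * V"
        by (intro inverse_unique) (simp add: mult_ac)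
      \<comment> \<open>An odd length has one more factor with odd exponent, hence
        \<open>Suc m\<close> here and in \<open>V\<close>.\<close>
      moreover have "qpoch q q (2 * m + 1) = qpoch q (q\<^sup>2) (Suc m) * W"
        using qpoch_double[of q q m] by (simp add: W_def qpoch_Suc qq flip: power2_eq_square)
      ultimately show ?thesis
        by (simp add: divide_inverse)
    qed
    also have "2 * P * (q ^ m\<^sup>2 * (q\<^sup>2) ^ m * q) * (q ^ m * qpoch (- q) (q\<^sup>2) m * B) * (P * V / W) / (1 + q ^ (2 * m + 1)) =
      2 * P\<^sup>2 * q * B * ((-1) ^ m * q ^ (m\<^sup>2 + m) * qpoch (- q) (q\<^sup>2) m * (- (q\<^sup>2)) ^ m * V / (W * (1 + q ^ (2 * m + 1))))"
    proof -
      have "(-1) ^ m * q ^ (m\<^sup>2 + m) * (- (q\<^sup>2)) ^ m = q ^ m\<^sup>2 * q ^ m * (q\<^sup>2) ^ m"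
        by (simp add: power_add power_minus[of "q\<^sup>2"])
      then show ?thesis
        by (simp add: power2_eq_square mult_ac)
    qed
    finally show ?thesis
      by (simp add: V_def W_def qq mult_ac)
  qed
  then have "((\<lambda>m. h (2 * m + 1)) has_sum (2 * P\<^sup>2 * q * B * (A * L2))) UNIV"
    using has_sum_cmult_right[OF J2, of "2 * P\<^sup>2 * q * B"] by (simp add: A_def)
  \<comment> \<open>The transform supplies \<open>B\<close> in the even part and \<open>A\<close> in
    the odd part, so by P = B A both carry the common factor 2 P^3.\<close>
  from has_sum_even_odd[OF even this] hS
  have "S = 2 * P\<^sup>2 * A * (B * L1) + 2 * P\<^sup>2 * q * B * (A * L2)"
    using has_sum_unique by blast
  also have "\<dots> = 2 * P ^ 3 * (L1 + q * L2)"
    unfolding P by (simp add: power2_eq_square power3_eq_cube algebra_simps)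
  also have "\<dots> = P ^ 3"
    unfolding \<open>L1 + q * L2 = 1 / 2\<close> by simp
  finally show ?thesis
    using S by (simp add: P_def q_def)
qed

text \<open>Splitting off the factor $1 - q^i$ of $(q;q)_i$ shows that the difference of the terms for
  $\alpha = -1$ and $\alpha = 1$ is the term for $\gamma = -2$ with $i$ shifted by one.\<close>

lemma has_sum_nahm_contiguous:
  assumes s: "norm s < 1" "s \<noteq> 0"
    and "(nahm s (- 1) \<beta> 0 has_sum S) UNIV" "(nahm s 1 \<beta> 0 has_sum T) UNIV"
  shows "(nahm s 1 \<beta> (- 2) has_sum (S - T)) UNIV"
proof -
  define f where "f = (\<lambda>x. nahm s (- 1) \<beta> 0 x - nahm s 1 \<beta> 0 x)"
  define shift :: "nat \<times> nat \<times> nat \<Rightarrow> nat \<times> nat \<times> nat" where "shift = (\<lambda>(i, j, k). (Suc i, j, k))"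
  define q where "q = s\<^sup>2"
  have q: "norm q < 1"
    unfolding q_def by (rule norm_power2_less_1[OF s(1)])
  \<comment> \<open>Raising \<alpha> by 2 multiplies the term by s^(2i) = q^i.\<close>
  have f_eq: "f (i, j, k) = s powi (int i ^ 2 + 2 * int j ^ 2 + 2 * int k ^ 2
      - 2 * int i * int k - 2 * int j * int k - int i + \<beta> * int j) * (1 - q ^ i)
      / (qpoch q q i * qpoch (q\<^sup>2) (q\<^sup>2) j * qpoch (q\<^sup>2) (q\<^sup>2) k)" for i j k
  proof -
    define e where "e = int i ^ 2 + 2 * int j ^ 2 + 2 * int k ^ 2
      - 2 * int i * int k - 2 * int j * int k - int i + \<beta> * int j"
    define D where "D = qpoch q q i * qpoch (q\<^sup>2) (q\<^sup>2) j * qpoch (q\<^sup>2) (q\<^sup>2) k"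
    have "s powi (e + int (2 * i)) = s powi e * s powi (int (2 * i))"
      using s by (intro power_int_add) auto
    then have "s powi (e + int (2 * i)) = s powi e * q ^ i"
      by (simp only: power_int_of_nat power_mult q_def)
    moreover have "nahm s (- 1) \<beta> 0 (i, j, k) = s powi e / D"
      by (simp add: nahm_def e_def D_def q_def[symmetric] algebra_simps)
    moreover have "nahm s 1 \<beta> 0 (i, j, k) = s powi (e + int (2 * i)) / D"
      by (simp add: nahm_def e_def D_def q_def[symmetric] algebra_simps)
    ultimately show ?thesis
      unfolding f_def e_def[symmetric] D_def[symmetric] by (simp add: diff_divide_distrib algebra_simps)
  qed
  have "f (shift x) = nahm s 1 \<beta> (- 2) x" for x
  proof -
    obtain i j k where x: "x = (i, j, k)"
      using prod_cases3 by blast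
    have "1 - q ^ Suc i \<noteq> 0"
      using mult_power_neq_1[OF q q, of i] by simp
    then have "f (shift x) = s powi (int (Suc i) ^ 2 + 2 * int j ^ 2 + 2 * int k ^ 2
      - 2 * int (Suc i) * int k - 2 * int j * int k - int (Suc i) + \<beta> * int j)
      / (qpoch q q i * qpoch (q\<^sup>2) (q\<^sup>2) j * qpoch (q\<^sup>2) (q\<^sup>2) k)"
      unfolding x shift_def prod.case f_eq qpoch_Suc by simp
    \<comment> \<open>Since (i+1)^2 - (i+1) = i^2 + i, the shift turns \<alpha> = -1 into \<alpha> =
      1, and -2(i+1)k yields the new -2k.\<close>
    also have "int (Suc i) ^ 2 + 2 * int j ^ 2 + 2 * int k ^ 2
      - 2 * int (Suc i) * int k - 2 * int j * int k - int (Suc i) + \<beta> * int j =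
      int i ^ 2 + 2 * int j ^ 2 + 2 * int k ^ 2
      - 2 * int i * int k - 2 * int j * int k + 1 * int i + \<beta> * int j + - 2 * int k"
      by (simp add: power2_eq_square algebra_simps)
    finally show ?thesis
      by (simp only: x nahm_def q_def prod.case)
  qed
  \<comment> \<open>The terms with i = 0 carry 1 - q^0 = 0, so only the range of
    \<open>shift\<close> contributes.\<close>
  moreover have "f x = 0" if "x \<notin> range shift" for x
  proof -
    obtain i j k where x: "x = (i, j, k)"
      using prod_cases3 by blast
    have "i = 0"
    proof (rule ccontr)
      assume "i \<noteq> 0"
      then have "x = shift (i - 1, j, k)"
        by (simp add: x shift_def)
      with that show False
        by blast
    qed
    then show ?thesis
      by (simp add: x f_eq)
  qed
  moreover have "(f has_sum (S - T)) UNIV"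
    unfolding f_def using has_sum_add[OF assms(3) has_sum_uminusI[OF assms(4)]] by simp
  then have "(f has_sum (S - T)) (range shift)"
    by (rule has_sum_cong_neutral[THEN iffD1, rotated -1]) (use calculation in auto)
  moreover have "inj shift"
    by (auto simp: inj_def shift_def)
  ultimately show ?thesis
    by (subst (asm) has_sum_reindex) (simp_all add: o_def)
qed

section \<open>The degenerate case q = 0\<close>

lemma has_sum_powi_0:
  fixes e :: "nat \<Rightarrow> nat \<Rightarrow> nat \<Rightarrow> int"
  assumes "finite B" "\<And>i j k. e i j k = 0 \<longleftrightarrow> (i, j, k) \<in> B"
  shows "((\<lambda>(i, j, k). 0 powi e i j k / (qpoch 0 0 i * qpoch 0 0 j * qpoch 0 0 k))
    has_sum of_nat (card B)) UNIV"
proof -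
  have "qpoch 0 0 n = 1" for n
    by (simp add: qpoch_def)
  \<comment> \<open>\<open>0 powi n\<close> is 1 for n = 0 and 0 otherwise, so the sum counts the
    zeros of the exponent.\<close>
  then show ?thesis
    using assms by (intro has_sum_finite_neutralI[of B]) (auto simp: power_int_0_left_if)
qed

text \<open>The exponent is (i-k)^2 + (k-j)^2 + j^2 + i + 2j, so every summand must vanish.\<close>

lemma exponent_eq_0_iff:
  "int i ^ 2 + 2 * int j ^ 2 + 2 * int k ^ 2 - 2 * int i * int k - 2 * int j * int k + int i + 2 * int j = 0
    \<longleftrightarrow> (i, j, k) \<in> {(0, 0, 0)}"
proof
  define a b where "a = int i - int k" and "b = int k - int j"
  assume "int i ^ 2 + 2 * int j ^ 2 + 2 * int k ^ 2 - 2 * int i * int k - 2 * int j * int k + int i + 2 * int j = 0"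
  then have "a\<^sup>2 + b\<^sup>2 + (int j)\<^sup>2 + int i + 2 * int j = 0"
    by (simp add: a_def b_def power2_eq_square algebra_simps)
  moreover have "a\<^sup>2 \<ge> 0" "b\<^sup>2 \<ge> 0" "(int j)\<^sup>2 \<ge> 0"
    by simp_all
  ultimately have "a\<^sup>2 = 0" "i = 0" "j = 0"
    by linarith+
  then show "(i, j, k) \<in> {(0, 0, 0)}"
    by (simp add: a_def)
qed simp

text \<open>With a = i - k and b = k - j the exponent is a(a+1) + b(b-1) + j(j+1). Products of
  consecutive integers are nonnegative, which leaves four cases, and a = -1, b = 0 would make i
  negative. The three solutions are the constant 3 of the second identity at q = 0.\<close>

lemma exponent_minus_2_eq_0_iff:
  "int i ^ 2 + 2 * int j ^ 2 + 2 * int k ^ 2 - 2 * int i * int k - 2 * int j * int k + int i + 2 * int j - 2 * int k = 0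
    \<longleftrightarrow> (i, j, k) \<in> {(0, 0, 0), (0, 0, 1), (1, 0, 1)}"
proof
  define a b where "a = int i - int k" and "b = int k - int j"
  assume "int i ^ 2 + 2 * int j ^ 2 + 2 * int k ^ 2 - 2 * int i * int k - 2 * int j * int k + int i + 2 * int j - 2 * int k = 0"
  then have 0: "a * (a + 1) + b * (b - 1) + int j * (int j + 1) = 0"
    by (simp add: a_def b_def power2_eq_square algebra_simps)
  have pos: "x * (x + 1) \<ge> 0" for x :: int
    by (cases "x \<ge> 0") (auto intro: mult_nonpos_nonpos)
  have "a * (a + 1) = 0" "b * (b - 1) = 0" "int j * (int j + 1) = 0"
    using 0 pos[of a] pos[of "b - 1", simplified mult.commute[of "b - 1"]] pos[of "int j"]
    unfolding diff_add_cancel by linarith+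
  then have "a = 0 \<or> a = - 1" "b = 0 \<or> b = 1" "j = 0"
    by auto
  then show "(i, j, k) \<in> {(0, 0, 0), (0, 0, 1), (1, 0, 1)}"
    unfolding a_def b_def by auto
qed auto

text \<open>Exponents are doubled, as powers of s = q^(1/2). The first identity contains q^(-1/2),
  hence its condition that s is nonzero.\<close>

theorem theorem1p3:
  fixes q s :: complex
  assumes "norm q < 1" and "s ^ 2 = q"
  shows "(s \<noteq> 0 \<longrightarrow>
           ((\<lambda>(i, j, k). s powi (int i ^ 2 + 2 * int j ^ 2 + 2 * int k ^ 2
                 - 2 * int i * int k - 2 * int j * int k - int i - int j)
               / (qpoch q q i * qpoch (q ^ 2) (q ^ 2) j * qpoch (q ^ 2) (q ^ 2) k))
            has_sum (4 * (1 + inverse s) * qpoch_inf (q ^ 2) (q ^ 2) / qpoch_inf s s))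
            (UNIV :: (nat \<times> nat \<times> nat) set))
       \<and> ((\<lambda>(i, j, k). s powi (int i ^ 2 + 2 * int j ^ 2 + 2 * int k ^ 2
                 - 2 * int i * int k - 2 * int j * int k + int i + 2 * int j - 2 * int k)
               / (qpoch q q i * qpoch (q ^ 2) (q ^ 2) j * qpoch (q ^ 2) (q ^ 2) k))
            has_sum (3 * qpoch_inf (q ^ 2) (q ^ 2) ^ 3 / qpoch_inf q q ^ 3))
            (UNIV :: (nat \<times> nat \<times> nat) set)
       \<and> ((\<lambda>(i, j, k). s powi (int i ^ 2 + 2 * int j ^ 2 + 2 * int k ^ 2
                 - 2 * int i * int k - 2 * int j * int k + int i + 2 * int j)
               / (qpoch q q i * qpoch (q ^ 2) (q ^ 2) j * qpoch (q ^ 2) (q ^ 2) k))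
            has_sum (qpoch_inf (q ^ 2) (q ^ 2) ^ 3 / qpoch_inf q q ^ 3))
            (UNIV :: (nat \<times> nat \<times> nat) set)"
\<comment> \<open>The addition law for \<open>powi\<close> fails at base 0, so that case is settled
  by counting zeros of the exponents.\<close>
proof (cases "s = 0")
  case True
  then have q: "q = 0"
    using assms by simp
  have inf: "qpoch_inf 0 0 = 1"
    by (simp add: qpoch_inf_def)
  have "((\<lambda>(i, j, k). 0 powi (int i ^ 2 + 2 * int j ^ 2 + 2 * int k ^ 2
      - 2 * int i * int k - 2 * int j * int k + int i + 2 * int j - 2 * int k)
      / (qpoch 0 0 i * qpoch 0 0 j * qpoch 0 0 k)) has_sum of_nat (card {(0, 0, 0), (0, 0, 1), (1, 0, 1) :: nat \<times> nat \<times> nat})) UNIV"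
    by (rule has_sum_powi_0[OF _ exponent_minus_2_eq_0_iff]) simp
  moreover have "((\<lambda>(i, j, k). 0 powi (int i ^ 2 + 2 * int j ^ 2 + 2 * int k ^ 2
      - 2 * int i * int k - 2 * int j * int k + int i + 2 * int j)
      / (qpoch 0 0 i * qpoch 0 0 j * qpoch 0 0 k)) has_sum of_nat (card {(0, 0, 0) :: nat \<times> nat \<times> nat})) UNIV"
    by (rule has_sum_powi_0[OF _ exponent_eq_0_iff]) simp
  ultimately show ?thesis
    using True q inf by simp
next
  case False
  define P where "P = qpoch_inf (- q) q"
  have s: "norm s < 1" "s \<noteq> 0"
    using assms False by (auto simp: norm_power power_less_one_iff)
  note q = assms(1)
  have qq: "qpoch_inf (q\<^sup>2) (q\<^sup>2) = qpoch_inf q q * P"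
    using qpoch_inf_mult_neg[OF q, of q] by (simp add: P_def)
  have qnz: "qpoch_inf q q \<noteq> 0"
    using q by (intro qpoch_inf_nonzero')
  have cube: "qpoch_inf (q\<^sup>2) (q\<^sup>2) ^ 3 / qpoch_inf q q ^ 3 = P ^ 3"
    using qnz by (simp add: qq power_mult_distrib)
  have S3: "(nahm s 1 2 0 has_sum P ^ 3) UNIV"
    using has_sum_nahm_1_2_0[OF s] assms by (simp add: P_def)
  \<comment> \<open>At \<beta> = 2 the last product is P as well; removing the third sum then leaves
    4 P^3 - P^3.\<close>
  have "(nahm s (- 1) 2 0 has_sum 4 * P ^ 3) UNIV"
    using has_sum_nahm_minus_1[OF s, of 2] assms
    by (simp add: P_def power2_eq_square power3_eq_cube mult_ac)
  from has_sum_nahm_contiguous[OF s this S3]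
  have S2: "(nahm s 1 2 (- 2) has_sum 3 * P ^ 3) UNIV"
    by simp
  have "inverse s * q = s"
    using s assms(2)[symmetric] by (simp add: power2_eq_square)
  \<comment> \<open>Splitting off the first factor of (-q^(-1/2);q)_\<infinity> produces the 1 +
    q^(-1/2) of the claim.\<close>
  then have "qpoch_inf (- (s powi - 1)) q = (1 + inverse s) * qpoch_inf (- s) q"
    using qpoch_inf_Suc[OF q, of "- inverse s"]
    by (simp add: power_int_minus)
  \<comment> \<open>As q = s^2, the two factors are the even and odd parts of (-s;s)_\<infinity>,
    the reciprocal of (s;s^2)_\<infinity> by \<open>euler_odd_distinct\<close>.\<close>
  moreover have "P * qpoch_inf (- s) q = 1 / qpoch_inf s q"
  proof -
    have "qpoch_inf (- s) s = qpoch_inf (- s) q * P"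
      using qpoch_inf_double[OF s(1), of "- s"] assms(2) by (simp add: P_def power2_eq_square)
    then have "qpoch_inf s q * (P * qpoch_inf (- s) q) = 1"
      using euler_odd_distinct[OF s(1)] assms(2) by (simp add: mult_ac)
    then show ?thesis
      by (metis inverse_eq_divide inverse_unique)
  qed
  moreover have "qpoch_inf s s = qpoch_inf s q * qpoch_inf q q"
    using qpoch_inf_double[OF s(1), of s] assms(2) by (simp add: power2_eq_square)
  moreover have "4 * P\<^sup>2 * ((1 + inverse s) * qpoch_inf (- s) q) =
      4 * (1 + inverse s) * P * (P * qpoch_inf (- s) q)"
    by (simp add: power2_eq_square)
  ultimately have "4 * P\<^sup>2 * qpoch_inf (- (s powi - 1)) q =
      4 * (1 + inverse s) * qpoch_inf (q\<^sup>2) (q\<^sup>2) / qpoch_inf s s"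
    unfolding qq using qnz by simp
  then have S1: "(nahm s (- 1) (- 1) 0 has_sum
      4 * (1 + inverse s) * qpoch_inf (q\<^sup>2) (q\<^sup>2) / qpoch_inf s s) UNIV"
    using has_sum_nahm_minus_1[OF s, of "- 1"] assms by (simp add: P_def)
  show ?thesis
    using S1 S2 S3 unfolding cube times_divide_eq_right[symmetric] nahm_def assms by simp
qed

end
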